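(* Let $\mathcal{G}_1$ and $\mathcal{G}_2$ be directed acyclic graphs (DAGs) on the same vertex set $V$. Then $\mathcal{G}_1$ and $\mathcal{G}_2$ are model equivalent, i.e. $\mathcal{M}_{\mathcal{G}_1}=\mathcal{M}_{\mathcal{G}_2}$, if and only if $\mathcal{G}_1$ and $\mathcal{G}_2$ have the same skeleton and the induced subgraphs $\mathcal{G}_1[K]$ and $\mathcal{G}_2[K]$ are model equivalent, i.e. $\mathcal{M}_{\mathcal{G}_1[K]}=\mathcal{M}_{\mathcal{G}_2[K]}$, for all $K\subseteq V$ with $|K|=4$.
   Context: All graphs are finite directed graphs $\mathcal{G}=(V,E)$ without multiple edges, whose edge set $E\subseteq V\times V$ contains every self-loop $i\to i$, $i\in V$. Self-loops are ignored for acyclicity: a graph is acyclic (a DAG) if it has no directed cycle of length greater than one. The skeleton of $\mathcal{G}$ is the undirected graph on $V$ in which distinct $i,j$ are joined iff $i\to j\in E$ or $j\to i\in E$. For $K\subseteq V$, $\mathcal{G}[K]$ is the induced subgraph on $K$ (vertex set $K$, all edges of $\mathcal{G}$ with both endpoints in $K$). $\mathbb{R}^E$ denotes the set of real $V\times V$ matrices $M=(m_{ij})$ with $m_{ji}=0$ whenever $i\to j\notin E$. A real square matrix is stable if all its eigenvalues have strictly negative real part. $\mathrm{PD}_V$ is the set of real symmetric positive definite $V\times V$ matrices and $I$ the identity matrix. The graphical continuous Lyapunov model of $\mathcal{G}$ (with uncorrelated noise, normalized to volatility matrix $C=2I$) is $$\mathcal{M}_{\mathcal{G}}=\{\Sigma\in\mathrm{PD}_V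 : M\Sigma+\Sigma M^T+2I=0\text{ for some stable }M\in\mathbb{R}^E\}.$$ Two graphs on the same vertex set are called model equivalent if their models are equal.
   Formalization: The case |V| = 3 is excluded: there no K with |K| = 4 exists, and the claim fails for 1→2→3 and 1→2←3, which have the same skeleton but different models (Σ₁₃ = 0 always holds only for the second). *)

theory Defs
  imports Complex_Main "HOL-Library.FuncSet" "Graph_Theory.Digraph_Component"
begin

text \<open>
  A graph is a \<^typ>\<open>'v pair_pre_digraph\<close>: a vertex set together with a set of edges, each edge
  being a pair of vertices. Induced subgraphs are those of the library, \<^term>\<open>G \<restriction> K\<close>; their
  edges are of the general form of \<^typ>\<open>('v, 'b) pre_digraph\<close>, so the model is defined at that
  type, and a pair graph is coerced to it by \<^const>\<open>with_proj\<close>. An edge from \<open>i\<close> to \<open>j\<close> is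
  \<open>(i, j) \<in> arcs_ends G\<close>.
\<close>

definition all_self_loops :: "'v pair_pre_digraph \<Rightarrow> bool" where
  "all_self_loops G \<longleftrightarrow> (\<forall>i \<in> pverts G. (i, i) \<in> parcs G)"

text \<open>
  A \<^const>\<open>pre_digraph.cycle\<close> visits pairwise distinct vertices, so one of length greater than
  one uses no self-loop.
\<close>

definition dag :: "'v pair_pre_digraph \<Rightarrow> bool" where
  "dag G \<longleftrightarrow> pair_fin_digraph G \<and> all_self_loops G \<and>
     \<not> (\<exists>p. pre_digraph.cycle (with_proj G) p \<and> length p > 1)"

definition skeleton :: "'v pair_pre_digraph \<Rightarrow> 'v set \<times> 'v set set" where
  "skeleton G = (pverts G,
     {{i, j} | i j. i \<noteq> j \<and> ((i, j) \<in> parcs G \<or> (j, i) \<in> parcs G)})"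

text \<open>
  A \<open>V \<times> V\<close> matrix is a function on \<open>V \<times> V\<close>, extended by \<^const>\<open>undefined\<close> to all pairs; thus
  matrices over \<open>V\<close> are equal iff their entries indexed by \<open>V \<times> V\<close> are.
\<close>

definition real_matrices :: "'v set \<Rightarrow> ('v \<times> 'v \<Rightarrow> real) set" where
  "real_matrices V = V \<times> V \<rightarrow>\<^sub>E UNIV"

text \<open>The set \<open>\<real>\<^sup>E\<close>. Note the transposition: an edge from \<open>i\<close> to \<open>j\<close> permits the entry \<open>m\<^sub>j\<^sub>i\<close>.\<close>

definition edge_matrices :: "('v, 'b) pre_digraph \<Rightarrow> ('v \<times> 'v \<Rightarrow> real) set" where
  "edge_matrices G = {M \<in> real_matrices (verts G).
     \<forall>i \<in> verts G. \<forall>j \<in> verts G. (i, j) \<notin> arcs_ends G \<longrightarrow> M (j, i) = 0}"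

definition is_eigenvalue :: "'v set \<Rightarrow> ('v \<times> 'v \<Rightarrow> real) \<Rightarrow> complex \<Rightarrow> bool" where
  "is_eigenvalue V M l \<longleftrightarrow> (\<exists>x :: 'v \<Rightarrow> complex. (\<exists>i \<in> V. x i \<noteq> 0) \<and>
     (\<forall>i \<in> V. (\<Sum>j\<in>V. complex_of_real (M (i, j)) * x j) = l * x i))"

definition stable :: "'v set \<Rightarrow> ('v \<times> 'v \<Rightarrow> real) \<Rightarrow> bool" where
  "stable V M \<longleftrightarrow> (\<forall>l. is_eigenvalue V M l \<longrightarrow> Re l < 0)"

definition PD :: "'v set \<Rightarrow> ('v \<times> 'v \<Rightarrow> real) set" where
  "PD V = {S \<in> real_matrices V.
     (\<forall>i \<in> V. \<forall>j \<in> V. S (i, j) = S (j, i)) \<and>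
     (\<forall>x :: 'v \<Rightarrow> real. (\<exists>i \<in> V. x i \<noteq> 0) \<longrightarrow> (\<Sum>i\<in>V. \<Sum>j\<in>V. x i * S (i, j) * x j) > 0)}"

text \<open>The matrix equation \<open>M S + S M\<^sup>T + 2 I = 0\<close>, entry by entry.\<close>

definition lyapunov_equation ::
    "'v set \<Rightarrow> ('v \<times> 'v \<Rightarrow> real) \<Rightarrow> ('v \<times> 'v \<Rightarrow> real) \<Rightarrow> bool" where
  "lyapunov_equation V M S \<longleftrightarrow> (\<forall>i \<in> V. \<forall>j \<in> V.
     (\<Sum>k\<in>V. M (i, k) * S (k, j)) + (\<Sum>k\<in>V. S (i, k) * M (j, k)) +
     2 * (if i = j then 1 else 0) = 0)"

definition lyapunov_model :: "('v, 'b) pre_digraph \<Rightarrow> ('v \<times> 'v \<Rightarrow> real) set" where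
  "lyapunov_model G = {S \<in> PD (verts G).
     \<exists>M \<in> edge_matrices G. stable (verts G) M \<and> lyapunov_equation (verts G) M S}"

definition model_equivalent :: "('v, 'b) pre_digraph \<Rightarrow> ('v, 'c) pre_digraph \<Rightarrow> bool" where
  "model_equivalent G H \<longleftrightarrow> lyapunov_model G = lyapunov_model H"

end

theory Submission
  imports Defs
begin

text \<open>
  By Lyapunov's argument stability is automatic, so \<open>\<Sigma>\<close> lies in the model iff it is positive definite and
  solves the Lyapunov equation for some \<open>M\<close> with the prescribed support. As \<open>\<Sigma>\<close> lies in the model of
  \<open>G[K]\<close> iff \<open>\<Sigma> \<oplus> I\<close> lies in that of \<open>G\<close>, model equivalence passes to induced subgraphs; the case of two
  vertices gives the skeleton.

  Conversely, let \<open>i \<rightarrow> j\<close> be reversed between the two graphs. Separating small graphs by explicit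
  covariance matrices shows that \<open>i\<close> and \<open>j\<close> have the same neighbours, that two nonadjacent common
  neighbours are both parents or both children of \<open>i, j\<close>, and that a common neighbour \<open>u\<close> with a neighbour
  \<open>v\<close> not adjacent to \<open>i\<close> satisfies \<open>v \<rightarrow> u\<close> and \<open>i, j \<rightarrow> u\<close>. If no triangle \<open>i \<rightarrow> k \<rightarrow> j\<close> exists, then the set
  \<open>B\<close> of \<open>i\<close>, \<open>j\<close> and their parents is ancestral, the vertices \<open>Q\<close> not adjacent to \<open>i\<close> are ancestral, and
  every other vertex is a child of all of \<open>B\<close>. Hence \<open>\<Sigma>\<close> vanishes on \<open>Q \<times> B\<close>. With \<open>p\<^sub>i, p\<^sub>j\<close> supported on
  \<open>B\<close> such that \<open>\<Sigma> p\<^sub>i\<close> and \<open>\<Sigma> p\<^sub>j\<close> are unit vectors on \<open>B\<close>, a suitable multiple of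
  \<open>\<Sigma> p\<^sub>i p\<^sub>j\<^sup>T - \<Sigma> p\<^sub>j p\<^sub>i\<^sup>T\<close> added to \<open>M\<close> keeps the Lyapunov equation and moves \<open>M\<close> to the support of the
  graph with \<open>j \<rightarrow> i\<close>. Reversing edges one at a time, always one that spans the fewest ranks, leads from
  one graph to the other.
\<close>

section \<open>Lyapunov equations\<close>

text \<open>\<open>PD\<close> without extensionality, so that one function \<open>S\<close> can be
  judged on every subset of \<open>V\<close>.\<close>

definition pos_def :: "'v set \<Rightarrow> ('v \<times> 'v \<Rightarrow> real) \<Rightarrow> bool" where
  "pos_def V S \<longleftrightarrow> (\<forall>i\<in>V. \<forall>j\<in>V. S (i, j) = S (j, i)) \<and>
     (\<forall>x :: 'v \<Rightarrow> real. (\<exists>i\<in>V. x i \<noteq> 0) \<longrightarrow> (\<Sum>i\<in>V. \<Sum>j\<in>V. x i * S (i, j) * x j) > 0)"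

lemma PD_iff: "S \<in> PD V \<longleftrightarrow> S \<in> real_matrices V \<and> pos_def V S"
  by (auto simp: PD_def pos_def_def)

lemma pos_def_cong:
  assumes "\<And>i j. i \<in> V \<Longrightarrow> j \<in> V \<Longrightarrow> S (i, j) = T (i, j)"
  shows "pos_def V S \<longleftrightarrow> pos_def V T"
  using assms unfolding pos_def_def by (simp cong: sum.cong)

lemma lyapunov_equation_cong:
  assumes "\<And>i j. i \<in> V \<Longrightarrow> j \<in> V \<Longrightarrow> M (i, j) = N (i, j)"
    and "\<And>i j. i \<in> V \<Longrightarrow> j \<in> V \<Longrightarrow> S (i, j) = T (i, j)"
  shows "lyapunov_equation V M S \<longleftrightarrow> lyapunov_equation V N T"
  using assms unfolding lyapunov_equation_def by (simp cong: sum.cong)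

lemma pos_def_sym: "pos_def V S \<Longrightarrow> i \<in> V \<Longrightarrow> j \<in> V \<Longrightarrow> S (i, j) = S (j, i)"
  by (simp add: pos_def_def)

lemma pos_def_pos:
  "pos_def V S \<Longrightarrow> i \<in> V \<Longrightarrow> x i \<noteq> 0 \<Longrightarrow> (\<Sum>i\<in>V. \<Sum>j\<in>V. x i * S (i, j) * x j) > 0"
  unfolding pos_def_def by blast

lemma pos_def_subset:
  assumes "pos_def V S" "K \<subseteq> V" "finite V"
  shows "pos_def K S"
  unfolding pos_def_def
proof (intro conjI allI impI ballI)
  fix x :: "'a \<Rightarrow> real" assume "\<exists>i\<in>K. x i \<noteq> 0"
  then obtain i where i: "i \<in> K" "x i \<noteq> 0" by blast
  define y where "y = (\<lambda>i. if i \<in> K then x i else 0)"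
  have "(\<Sum>i\<in>V. \<Sum>j\<in>V. y i * S (i, j) * y j) > 0"
    by (rule pos_def_pos[OF assms(1), of i]) (use i assms(2) in \<open>auto simp: y_def\<close>)
  also have "(\<Sum>i\<in>V. \<Sum>j\<in>V. y i * S (i, j) * y j) = (\<Sum>i\<in>K. \<Sum>j\<in>K. x i * S (i, j) * x j)"
  proof -
    have "(\<Sum>j\<in>V. y i * S (i, j) * y j) = (\<Sum>j\<in>K. y i * S (i, j) * x j)" for i
      by (rule sum.mono_neutral_cong_right) (use assms in \<open>auto simp: y_def\<close>)
    moreover have "(\<Sum>i\<in>V. \<Sum>j\<in>K. y i * S (i, j) * x j) = (\<Sum>i\<in>K. \<Sum>j\<in>K. x i * S (i, j) * x j)"
      by (rule sum.mono_neutral_cong_right) (use assms in \<open>auto simp: y_def\<close>)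
    ultimately show ?thesis by simp
  qed
  finally show "(\<Sum>i\<in>K. \<Sum>j\<in>K. x i * S (i, j) * x j) > 0" .
qed (rule pos_def_sym[OF assms(1)]; use assms(2) in blast)

text \<open>Elimination of one coordinate \<open>s\<close>: the Schur complement of the block on
  \<open>V\<close> is positive, so a solution on \<open>V\<close> extends to
  \<open>insert s V\<close>.\<close>

lemma pos_def_solve:
  assumes "finite V" "pos_def V S"
  shows "\<exists>p. \<forall>i\<in>V. (\<Sum>j\<in>V. S (i, j) * p j) = b i"
  using assms
proof (induction V arbitrary: b rule: finite_induct)
  case empty
  then show ?case by simp
next
  case (insert s V)
  have pd: "pos_def V S" using pos_def_subset[OF insert.prems, of V] insert.hyps by auto
  obtain q where q: "\<And>i. i \<in> V \<Longrightarrow> (\<Sum>j\<in>V. S (i, j) * q j) = S (i, s)"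
    using insert.IH[OF pd, of "\<lambda>i. S (i, s)"] by auto
  obtain u where u: "\<And>i. i \<in> V \<Longrightarrow> (\<Sum>j\<in>V. S (i, j) * u j) = b i"
    using insert.IH[OF pd, of b] by auto
  \<comment> \<open>\<open>S z\<close> is \<open>c\<close> times the unit vector at
    \<open>s\<close>. As \<open>z s = 1\<close>, the Schur complement \<open>c\<close> is the value
    of the quadratic form at \<open>z\<close>.\<close>
  define z where "z = (\<lambda>i. if i = s then 1 else - q i)"
  define c where "c = S (s, s) - (\<Sum>j\<in>V. S (s, j) * q j)"
  have rows: "(\<Sum>j\<in>insert s V. S (i, j) * z j) = (if i = s then c else 0)" if "i \<in> insert s V" for i
  proof -
    have "(\<Sum>j\<in>V. S (i, j) * z j) = - (\<Sum>j\<in>V. S (i, j) * q j)"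
      unfolding sum_negf[symmetric] using insert.hyps by (intro sum.cong) (auto simp: z_def)
    then show ?thesis using that q insert.hyps by (auto simp: z_def c_def)
  qed
  have "0 < (\<Sum>i\<in>insert s V. \<Sum>j\<in>insert s V. z i * S (i, j) * z j)"
    by (rule pos_def_pos[OF insert.prems, of s]) (auto simp: z_def)
  also have "\<dots> = (\<Sum>i\<in>insert s V. z i * (if i = s then c else 0))"
    by (intro sum.cong refl) (simp only: rows[symmetric] sum_distrib_left mult.assoc)
  also have "\<dots> = c" using insert.hyps by (simp add: z_def if_distrib cong: if_cong)
  finally have c: "c > 0" .
  \<comment> \<open>Adding \<open>t * z\<close> corrects row \<open>s\<close> and leaves the other
    rows alone.\<close>
  define t where "t = (b s - (\<Sum>j\<in>V. S (s, j) * u j)) / c"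
  define p where "p = (\<lambda>i. (if i = s then 0 else u i) + t * z i)"
  have "(\<Sum>j\<in>insert s V. S (i, j) * p j) = b i" if i: "i \<in> insert s V" for i
  proof -
    have "(\<Sum>j\<in>insert s V. S (i, j) * p j) =
      (\<Sum>j\<in>insert s V. S (i, j) * (if j = s then 0 else u j)) + t * (\<Sum>j\<in>insert s V. S (i, j) * z j)"
      by (simp only: p_def distrib_left sum.distrib sum_distrib_left mult.left_commute)
    also have "(\<Sum>j\<in>insert s V. S (i, j) * (if j = s then 0 else u j)) = (\<Sum>j\<in>V. S (i, j) * u j)"
      using insert.hyps by (auto intro!: sum.cong)
    also have "(\<Sum>j\<in>V. S (i, j) * u j) + t * (\<Sum>j\<in>insert s V. S (i, j) * z j) = b i"
      using i u c unfolding rows[OF i] t_def by auto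
    finally show ?thesis .
  qed
  then show ?case by blast
qed

text \<open>A quadratic form sees only the symmetric part of a matrix, and the equation says that
  the symmetric part of \<open>M S\<close> is \<open>- I\<close>.\<close>

lemma lyapunov_quadratic_form:
  assumes "finite V" "lyapunov_equation V M S"
    and "\<And>i j. i \<in> V \<Longrightarrow> j \<in> V \<Longrightarrow> S (i, j) = S (j, i)"
  shows "(\<Sum>i\<in>V. y i * (\<Sum>k\<in>V. M (i, k) * (\<Sum>j\<in>V. S (k, j) * y j))) = - (\<Sum>i\<in>V. y i * y i)"
proof -
  define A where "A = (\<lambda>i j. \<Sum>k\<in>V. M (i, k) * S (k, j))"
  have eq: "A i j + A j i + 2 * (if i = j then 1 else 0) = 0" if "i \<in> V" "j \<in> V" for i j
  proof -
    have "A j i = (\<Sum>k\<in>V. S (i, k) * M (j, k))"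
      using assms(3) that unfolding A_def by (intro sum.cong) (auto simp: mult.commute)
    then show ?thesis using assms(2) that unfolding lyapunov_equation_def A_def by simp
  qed
  have "(\<Sum>k\<in>V. M (i, k) * (\<Sum>j\<in>V. S (k, j) * y j)) = (\<Sum>j\<in>V. A i j * y j)" for i
    unfolding A_def sum_distrib_left sum_distrib_right
    by (subst sum.swap) (simp add: mult.assoc)
  then have L: "(\<Sum>i\<in>V. y i * (\<Sum>k\<in>V. M (i, k) * (\<Sum>j\<in>V. S (k, j) * y j))) =
      (\<Sum>i\<in>V. \<Sum>j\<in>V. y i * A i j * y j)" (is "?L = _")
    by (simp add: sum_distrib_left mult.assoc)
  also have "\<dots> = (\<Sum>i\<in>V. \<Sum>j\<in>V. y i * A j i * y j)"
    by (subst sum.swap) (simp add: mult.commute mult.left_commute)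
  finally have "2 * ?L = (\<Sum>i\<in>V. \<Sum>j\<in>V. y i * A i j * y j) + (\<Sum>i\<in>V. \<Sum>j\<in>V. y i * A j i * y j)"
    using L by simp
  also have "\<dots> = (\<Sum>i\<in>V. \<Sum>j\<in>V. y i * (A i j + A j i) * y j)"
    by (simp add: sum.distrib[symmetric] distrib_left distrib_right)
  also have "\<dots> = (\<Sum>i\<in>V. \<Sum>j\<in>V. y i * (if i = j then -2 else 0) * y j)"
  proof (intro sum.cong refl)
    fix i j assume "i \<in> V" "j \<in> V"
    with eq[of i j] have "A i j + A j i = (if i = j then -2 else 0)" by (auto split: if_splits)
    then show "y i * (A i j + A j i) * y j = y i * (if i = j then -2 else 0) * y j" by simp
  qed
  also have "\<dots> = (\<Sum>i\<in>V. -2 * (y i * y i))"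
  proof (intro sum.cong refl)
    fix i assume "i \<in> V"
    have "(\<Sum>j\<in>V. y i * (if i = j then -2 else 0) * y j) = (\<Sum>j\<in>V. if i = j then -2 * (y i * y i) else 0)"
      by (intro sum.cong) auto
    then show "(\<Sum>j\<in>V. y i * (if i = j then -2 else 0) * y j) = -2 * (y i * y i)"
      using assms(1) \<open>i \<in> V\<close> by simp
  qed
  also have "\<dots> = 2 * - (\<Sum>i\<in>V. y i * y i)" by (simp add: sum_distrib_left sum_negf)
  finally show ?thesis by simp
qed

text \<open>The real and imaginary parts of an eigenvector are written as \<open>S y\<close> and
  \<open>S z\<close>. Adding the quadratic form identities for \<open>y\<close> and \<open>z\<close>
  shows that \<open>Re l * (Q y + Q z)\<close> is negative, where \<open>Q\<close> is the form of
  \<open>S\<close>.\<close>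

lemma lyapunov_stable:
  assumes "finite V" "pos_def V S" "lyapunov_equation V M S"
  shows "stable V M"
  unfolding stable_def
proof (intro allI impI)
  fix l assume "is_eigenvalue V M l"
  then obtain x where x: "\<exists>i\<in>V. x i \<noteq> 0"
    "\<And>i. i \<in> V \<Longrightarrow> (\<Sum>j\<in>V. complex_of_real (M (i, j)) * x j) = l * x i"
    unfolding is_eigenvalue_def by blast
  note sym = pos_def_sym[OF assms(2)]
  obtain y where y: "\<And>i. i \<in> V \<Longrightarrow> (\<Sum>j\<in>V. S (i, j) * y j) = Re (x i)"
    using pos_def_solve[OF assms(1,2), of "\<lambda>i. Re (x i)"] by auto
  obtain z where z: "\<And>i. i \<in> V \<Longrightarrow> (\<Sum>j\<in>V. S (i, j) * z j) = Im (x i)"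
    using pos_def_solve[OF assms(1,2), of "\<lambda>i. Im (x i)"] by auto
  have re: "(\<Sum>j\<in>V. M (i, j) * Re (x j)) = Re l * Re (x i) - Im l * Im (x i)"
    and im: "(\<Sum>j\<in>V. M (i, j) * Im (x j)) = Re l * Im (x i) + Im l * Re (x i)" if "i \<in> V" for i
    using arg_cong[OF x(2)[OF that], of Re] arg_cong[OF x(2)[OF that], of Im] by simp_all
  have qy: "(\<Sum>i\<in>V. y i * (Re l * Re (x i) - Im l * Im (x i))) = - (\<Sum>i\<in>V. y i * y i)"
    using lyapunov_quadratic_form[OF assms(1,3) sym, of y] by (simp add: y re cong: sum.cong)
  have qz: "(\<Sum>i\<in>V. z i * (Re l * Im (x i) + Im l * Re (x i))) = - (\<Sum>i\<in>V. z i * z i)"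
    using lyapunov_quadratic_form[OF assms(1,3) sym, of z] by (simp add: z im cong: sum.cong)
  \<comment> \<open>By symmetry of \<open>S\<close> the terms with \<open>Im l\<close> cancel when
    the two identities are added.\<close>
  have cross: "(\<Sum>i\<in>V. y i * Im (x i)) = (\<Sum>i\<in>V. z i * Re (x i))"
  proof -
    have "(\<Sum>i\<in>V. y i * Im (x i)) = (\<Sum>i\<in>V. \<Sum>j\<in>V. y i * (S (i, j) * z j))"
      by (simp add: z[symmetric] sum_distrib_left cong: sum.cong)
    also have "\<dots> = (\<Sum>i\<in>V. \<Sum>j\<in>V. y j * (S (j, i) * z i))" by (rule sum.swap)
    also have "\<dots> = (\<Sum>i\<in>V. \<Sum>j\<in>V. z i * (S (i, j) * y j))"
      using sym by (intro sum.cong refl) (simp add: mult.commute mult.left_commute)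
    finally show ?thesis by (simp add: y[symmetric] sum_distrib_left cong: sum.cong)
  qed
  define Q where "Q = (\<lambda>w. \<Sum>i\<in>V. \<Sum>j\<in>V. w i * S (i, j) * w j)"
  have Qy: "(\<Sum>i\<in>V. y i * Re (x i)) = Q y" and Qz: "(\<Sum>i\<in>V. z i * Im (x i)) = Q z"
    unfolding Q_def by (simp_all add: y[symmetric] z[symmetric] sum_distrib_left mult.assoc cong: sum.cong)
  have Qpos: "Q w > 0" if "\<exists>i\<in>V. w i \<noteq> 0" for w
    using assms(2) that unfolding Q_def pos_def_def by blast
  have Qge: "Q w \<ge> 0" for w
  proof (cases "\<exists>i\<in>V. w i \<noteq> 0")
    case False
    then have "Q w = 0" unfolding Q_def by (intro sum.neutral ballI) auto
    then show ?thesis by simp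
  qed (use Qpos in \<open>simp add: less_imp_le\<close>)
  have "(\<Sum>i\<in>V. y i * (Re l * Re (x i) - Im l * Im (x i))) = Re l * Q y - Im l * (\<Sum>i\<in>V. y i * Im (x i))"
    unfolding Qy[symmetric] by (simp add: right_diff_distrib sum_subtractf sum_distrib_left mult.left_commute)
  moreover have "(\<Sum>i\<in>V. z i * (Re l * Im (x i) + Im l * Re (x i))) = Re l * Q z + Im l * (\<Sum>i\<in>V. y i * Im (x i))"
    unfolding Qz[symmetric] cross by (simp add: distrib_left sum.distrib sum_distrib_left mult.left_commute)
  ultimately have main: "Re l * (Q y + Q z) = - (\<Sum>i\<in>V. y i * y i + z i * z i)"
    using qy qz by (simp add: sum.distrib distrib_left)
  obtain i where i: "i \<in> V" "x i \<noteq> 0" using x(1) by blast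
  have ex: "(\<exists>j\<in>V. y j \<noteq> 0) \<or> (\<exists>j\<in>V. z j \<noteq> 0)"
  proof (rule ccontr)
    assume "\<not> ?thesis"
    then have "Re (x i) = 0" "Im (x i) = 0" using y[OF i(1)] z[OF i(1)] by (simp_all cong: sum.cong)
    then show False using i(2) complex_eq_iff by simp
  qed
  then have "Q y + Q z > 0" using Qpos Qge by (metis add_pos_nonneg add_nonneg_pos)
  moreover have "(\<Sum>i\<in>V. y i * y i + z i * z i) > 0"
  proof -
    from ex obtain j where j: "j \<in> V" "y j \<noteq> 0 \<or> z j \<noteq> 0" by blast
    then have "y j * y j + z j * z j > 0"
      by (metis add_nonneg_pos add_pos_nonneg not_real_square_gt_zero zero_le_square)
    then show ?thesis using j(1) assms(1) by (intro sum_pos2[of V j]) auto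
  qed
  ultimately show "Re l < 0" using main by (metis mult_less_0_iff neg_less_0_iff_less not_less_iff_gr_or_eq)
qed

section \<open>Models and induced subgraphs\<close>

text \<open>Stability is omitted, being a consequence by \<open>lyapunov_stable\<close>.\<close>

definition cov_model :: "'v set \<Rightarrow> ('v \<times> 'v) set \<Rightarrow> ('v \<times> 'v \<Rightarrow> real) set" where
  "cov_model V E = {S \<in> PD V. \<exists>M. (\<forall>i\<in>V. \<forall>j\<in>V. (i, j) \<notin> E \<longrightarrow> M (j, i) = 0) \<and> lyapunov_equation V M S}"

lemma cov_modelI:
  assumes "S \<in> real_matrices V" "pos_def V S" "lyapunov_equation V M S"
    and "\<And>i j. i \<in> V \<Longrightarrow> j \<in> V \<Longrightarrow> (i, j) \<notin> E \<Longrightarrow> M (j, i) = 0"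
  shows "S \<in> cov_model V E"
  using assms unfolding cov_model_def PD_iff by blast

lemma cov_modelE:
  assumes "S \<in> cov_model V E"
  obtains M where "S \<in> real_matrices V" "pos_def V S" "lyapunov_equation V M S"
    and "\<And>i j. i \<in> V \<Longrightarrow> j \<in> V \<Longrightarrow> (i, j) \<notin> E \<Longrightarrow> M (j, i) = 0"
  using assms unfolding cov_model_def PD_iff by blast

lemma lyapunov_model_eq_cov_model:
  assumes "finite (verts G)"
  shows "lyapunov_model G = cov_model (verts G) (arcs_ends G)"
proof (intro equalityI subsetI)
  fix S assume "S \<in> lyapunov_model G"
  then show "S \<in> cov_model (verts G) (arcs_ends G)"
    unfolding lyapunov_model_def cov_model_def edge_matrices_def by blast
next
  fix S assume "S \<in> cov_model (verts G) (arcs_ends G)"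
  then obtain M where S: "S \<in> real_matrices (verts G)" "pos_def (verts G) S"
    and M: "lyapunov_equation (verts G) M S"
      "\<And>i j. i \<in> verts G \<Longrightarrow> j \<in> verts G \<Longrightarrow> (i, j) \<notin> arcs_ends G \<Longrightarrow> M (j, i) = 0"
    by (elim cov_modelE) blast
  \<comment> \<open>Entries of \<open>M\<close> outside the index set are arbitrary, whereas
    \<open>edge_matrices\<close> wants them \<open>undefined\<close>.\<close>
  define N where "N = restrict M (verts G \<times> verts G)"
  have "N \<in> edge_matrices G" using M(2) by (auto simp: N_def edge_matrices_def real_matrices_def)
  moreover have "lyapunov_equation (verts G) N S"
    using M(1) lyapunov_equation_cong[of "verts G" N M S S] by (simp add: N_def)
  ultimately show "S \<in> lyapunov_model G"
    using S lyapunov_stable[OF assms] unfolding lyapunov_model_def PD_iff by blast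
qed

lemma cov_model_cong:
  assumes "\<And>i j. i \<in> V \<Longrightarrow> j \<in> V \<Longrightarrow> (i, j) \<in> E \<longleftrightarrow> (i, j) \<in> F"
  shows "cov_model V E = cov_model V F"
  using assms unfolding cov_model_def by (intro Collect_cong conj_cong refl ex_cong1 ball_cong) auto

text \<open>One row of a block matrix that is \<open>c\<close> times the identity off
  \<open>K\<close>; needed with \<open>c = 1\<close> for covariances and \<open>c = -1\<close> for
  coefficients.\<close>

lemma sum_block_row:
  fixes A B :: "'v \<Rightarrow> real"
  assumes "finite V" "K \<subseteq> V" "i \<in> V"
  shows "(\<Sum>k\<in>V. (if i \<in> K \<and> k \<in> K then A k else if i = k then c else 0) * B k) =
    (if i \<in> K then \<Sum>k\<in>K. A k * B k else c * B i)"
proof (cases "i \<in> K")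
  case True
  then show ?thesis using assms
    by (simp, intro sum.mono_neutral_cong_right) auto
next
  case False
  then have "(\<Sum>k\<in>V. (if i \<in> K \<and> k \<in> K then A k else if i = k then c else 0) * B k) =
    (\<Sum>k\<in>V. if i = k then c * B k else 0)" by (intro sum.cong) auto
  with False show ?thesis using assms by simp
qed

definition identity_pad :: "'v set \<Rightarrow> 'v set \<Rightarrow> ('v \<times> 'v \<Rightarrow> real) \<Rightarrow> 'v \<times> 'v \<Rightarrow> real" where
  "identity_pad V K S = (\<lambda>(i, j) \<in> V \<times> V. if i \<in> K \<and> j \<in> K then S (i, j) else if i = j then 1 else 0)"

text \<open>The padded matrix vanishes between \<open>K\<close> and its complement, so its equation
  on \<open>K \<times> K\<close> is the one for \<open>S\<close>. Conversely, a solution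
  \<open>M\<close> is padded by \<open>-1\<close> on the diagonal, which self-loops permit.\<close>

lemma identity_pad_mem_cov_model_iff:
  assumes "finite V" "K \<subseteq> V" "\<And>i. i \<in> V \<Longrightarrow> (i, i) \<in> E" "S \<in> real_matrices K"
  shows "identity_pad V K S \<in> cov_model V E \<longleftrightarrow> S \<in> cov_model K E"
proof
  let ?T = "identity_pad V K S"
  have T: "?T (i, j) = (if i \<in> K \<and> j \<in> K then S (i, j) else if i = j then 1 else 0)"
    if "i \<in> V" "j \<in> V" for i j
    using that by (simp add: identity_pad_def)
  have fK: "finite K" using assms(1,2) by (rule rev_finite_subset)
  {
    assume "?T \<in> cov_model V E"
    then obtain M where pd: "pos_def V ?T" and M: "lyapunov_equation V M ?T"
      "\<And>i j. i \<in> V \<Longrightarrow> j \<in> V \<Longrightarrow> (i, j) \<notin> E \<Longrightarrow> M (j, i) = 0"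
      by (elim cov_modelE) blast
    have ST: "?T (i, j) = S (i, j)" if "i \<in> K" "j \<in> K" for i j
      using T[of i j] that assms(2) by auto
    have "pos_def K S"
      using pos_def_subset[OF pd assms(2,1)] pos_def_cong[of K ?T S] ST by blast
    moreover have "lyapunov_equation K M S"
      unfolding lyapunov_equation_def
    proof (intro ballI)
      fix i j assume ij: "i \<in> K" "j \<in> K"
      have "(\<Sum>k\<in>V. M (i, k) * ?T (k, j)) = (\<Sum>k\<in>K. M (i, k) * S (k, j))"
        by (rule sum.mono_neutral_cong_right) (use ij assms(1,2) T in \<open>auto simp: subset_eq\<close>)
      moreover have "(\<Sum>k\<in>V. ?T (i, k) * M (j, k)) = (\<Sum>k\<in>K. S (i, k) * M (j, k))"
        by (rule sum.mono_neutral_cong_right) (use ij assms(1,2) T in \<open>auto simp: subset_eq\<close>)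
      moreover have "i \<in> V" "j \<in> V" using ij assms(2) by auto
      ultimately show "(\<Sum>k\<in>K. M (i, k) * S (k, j)) + (\<Sum>k\<in>K. S (i, k) * M (j, k)) +
          2 * (if i = j then 1 else 0) = 0"
        using M(1) unfolding lyapunov_equation_def by fastforce
    qed
    ultimately show "S \<in> cov_model K E" using M(2) assms(2,4) by (intro cov_modelI) blast+
  next
    assume "S \<in> cov_model K E"
    then obtain M where pd: "pos_def K S" and M: "lyapunov_equation K M S"
      "\<And>i j. i \<in> K \<Longrightarrow> j \<in> K \<Longrightarrow> (i, j) \<notin> E \<Longrightarrow> M (j, i) = 0"
      by (elim cov_modelE) blast
    \<comment> \<open>\<open>-1\<close> solves the scalar equation \<open>2 m + 2 = 0\<close> at
      each vertex outside \<open>K\<close>.\<close>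
    define N where "N = (\<lambda>(i, j). if i \<in> K \<and> j \<in> K then M (i, j) else if i = j then -1 else 0)"
    have N: "N (i, j) = (if i \<in> K \<and> j \<in> K then M (i, j) else if i = j then -1 else 0)" for i j
      by (simp add: N_def)
    have sym: "?T (i, j) = ?T (j, i)" if "i \<in> V" "j \<in> V" for i j
      using that pos_def_sym[OF pd] by (auto simp: T)
    have NT: "(\<Sum>k\<in>V. N (i, k) * ?T (k, j)) =
        (if i \<in> K then \<Sum>k\<in>K. M (i, k) * ?T (k, j) else - ?T (i, j))" if "i \<in> V" for i j
      unfolding N by (subst sum_block_row) (use that assms in auto)
    have "pos_def V ?T"
      unfolding pos_def_def
    proof (intro conjI allI impI)
      fix x :: "'a \<Rightarrow> real" assume x: "\<exists>i\<in>V. x i \<noteq> 0"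
      have row: "(\<Sum>j\<in>V. x i * ?T (i, j) * x j) =
          (if i \<in> K then \<Sum>j\<in>K. x i * S (i, j) * x j else x i * x i)" if "i \<in> V" for i
      proof -
        have "(\<Sum>j\<in>V. x i * ?T (i, j) * x j) =
            x i * (\<Sum>j\<in>V. (if i \<in> K \<and> j \<in> K then S (i, j) else if i = j then 1 else 0) * x j)"
          unfolding sum_distrib_left using that by (intro sum.cong refl) (simp add: T mult.assoc)
        also have "\<dots> = x i * (if i \<in> K then \<Sum>j\<in>K. S (i, j) * x j else 1 * x i)"
          using sum_block_row[OF assms(1,2) that, of "\<lambda>j. S (i, j)" 1 x] by simp
        finally show ?thesis by (simp add: sum_distrib_left mult.assoc)
      qed
      have split: "(\<Sum>i\<in>V. \<Sum>j\<in>V. x i * ?T (i, j) * x j) =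
          (\<Sum>i\<in>K. \<Sum>j\<in>K. x i * S (i, j) * x j) + (\<Sum>i\<in>V - K. x i * x i)"
      proof -
        have "(\<Sum>i\<in>K. \<Sum>j\<in>V. x i * ?T (i, j) * x j) = (\<Sum>i\<in>K. \<Sum>j\<in>K. x i * S (i, j) * x j)"
          by (rule sum.cong[OF refl]) (use assms(2) row in auto)
        moreover have "(\<Sum>i\<in>V - K. \<Sum>j\<in>V. x i * ?T (i, j) * x j) = (\<Sum>i\<in>V - K. x i * x i)"
          by (rule sum.cong[OF refl]) (use row in auto)
        ultimately show ?thesis
          using sum.subset_diff[OF assms(2,1), of "\<lambda>i. \<Sum>j\<in>V. x i * ?T (i, j) * x j"] by simp
      qed
      show "(\<Sum>i\<in>V. \<Sum>j\<in>V. x i * ?T (i, j) * x j) > 0"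
      proof (cases "\<exists>i\<in>K. x i \<noteq> 0")
        case True
        then have "(\<Sum>i\<in>K. \<Sum>j\<in>K. x i * S (i, j) * x j) > 0" using pd unfolding pos_def_def by blast
        then show ?thesis unfolding split by (intro add_pos_nonneg sum_nonneg) auto
      next
        case False
        then have "(\<Sum>i\<in>K. \<Sum>j\<in>K. x i * S (i, j) * x j) = 0" by (intro sum.neutral ballI) auto
        moreover obtain i where i: "i \<in> V - K" "x i \<noteq> 0" using x False by blast
        then have "(\<Sum>i\<in>V - K. x i * x i) > 0"
          using assms(1) by (intro sum_pos2[of _ i]) (auto simp: zero_less_mult_iff)
        ultimately show ?thesis unfolding split by simp
      qed
    qed (use sym in auto)
    moreover have "lyapunov_equation V N ?T"
      unfolding lyapunov_equation_def
    proof (intro ballI)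
      fix i j assume ij: "i \<in> V" "j \<in> V"
      have "(\<Sum>k\<in>V. ?T (i, k) * N (j, k)) = (\<Sum>k\<in>V. N (j, k) * ?T (k, i))"
        using ij by (intro sum.cong refl) (simp add: sym[of i] mult.commute)
      then have eq: "(\<Sum>k\<in>V. N (i, k) * ?T (k, j)) + (\<Sum>k\<in>V. ?T (i, k) * N (j, k)) =
          (if i \<in> K then \<Sum>k\<in>K. M (i, k) * ?T (k, j) else - ?T (i, j)) +
          (if j \<in> K then \<Sum>k\<in>K. M (j, k) * ?T (k, i) else - ?T (j, i))" using ij NT by simp
      have row: "(\<Sum>k\<in>K. M (i, k) * ?T (k, j)) = (if j \<in> K then \<Sum>k\<in>K. M (i, k) * S (k, j) else 0)"
        if "i \<in> V" "j \<in> V" for i j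
        using that assms(2) by (cases "j \<in> K") (auto simp: T subset_eq intro!: sum.cong sum.neutral)
      have lyap: "(\<Sum>k\<in>K. M (i, k) * S (k, j)) + (\<Sum>k\<in>K. M (j, k) * S (k, i)) +
          2 * (if i = j then 1 else 0) = 0" if "i \<in> K" "j \<in> K"
      proof -
        have "(\<Sum>k\<in>K. M (j, k) * S (k, i)) = (\<Sum>k\<in>K. S (i, k) * M (j, k))"
          using that pos_def_sym[OF pd] by (intro sum.cong refl) (simp add: mult.commute)
        with that M(1) show ?thesis unfolding lyapunov_equation_def by simp
      qed
      show "(\<Sum>k\<in>V. N (i, k) * ?T (k, j)) + (\<Sum>k\<in>V. ?T (i, k) * N (j, k)) +
          2 * (if i = j then 1 else 0) = 0"
        unfolding eq using ij lyap by (auto simp: row T)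
    qed
    moreover have "?T \<in> real_matrices V" by (auto simp: identity_pad_def real_matrices_def)
    moreover have "N (j, i) = 0" if "i \<in> V" "j \<in> V" "(i, j) \<notin> E" for i j
      using that assms(3) M(2) by (auto simp: N)
    ultimately show "?T \<in> cov_model V E" by (intro cov_modelI)
  }
qed

text \<open>A matrix separating the models on \<open>K\<close> would, once padded by the identity,
  separate those on \<open>V\<close>.\<close>

lemma cov_model_eq_subset:
  assumes "finite V" "K \<subseteq> V" "\<And>i. i \<in> V \<Longrightarrow> (i, i) \<in> E" "\<And>i. i \<in> V \<Longrightarrow> (i, i) \<in> F"
    and "cov_model V E = cov_model V F"
  shows "cov_model K E = cov_model K F"
proof -
  have "S \<in> cov_model K E \<longleftrightarrow> S \<in> cov_model K F" if "S \<in> real_matrices K" for S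
    using identity_pad_mem_cov_model_iff[of V K _ S] assms that by metis
  then show ?thesis by (auto elim: cov_modelE)
qed

section \<open>Ancestral sets\<close>

text \<open>\<open>M (a, k) \<noteq> 0\<close> stands for an edge \<open>k -> a\<close>, so
  \<open>A\<close> contains all its parents and the rows of \<open>A\<close> do not look
  outside.\<close>

lemma lyapunov_equation_ancestral:
  assumes "finite V" "lyapunov_equation V M S" "A \<subseteq> V"
    and "\<And>a k. a \<in> A \<Longrightarrow> k \<in> V \<Longrightarrow> M (a, k) \<noteq> 0 \<Longrightarrow> k \<in> A"
  shows "lyapunov_equation A M S"
  unfolding lyapunov_equation_def
proof (intro ballI)
  fix i j assume ij: "i \<in> A" "j \<in> A"
  have "(\<Sum>k\<in>V. M (i, k) * S (k, j)) = (\<Sum>k\<in>A. M (i, k) * S (k, j))"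
    by (rule sum.mono_neutral_right) (use ij assms in auto)
  moreover have "(\<Sum>k\<in>V. S (i, k) * M (j, k)) = (\<Sum>k\<in>A. S (i, k) * M (j, k))"
    by (rule sum.mono_neutral_right) (use ij assms in auto)
  moreover have "i \<in> V" "j \<in> V" using ij assms(3) by auto
  ultimately show "(\<Sum>k\<in>A. M (i, k) * S (k, j)) + (\<Sum>k\<in>A. S (i, k) * M (j, k)) +
      2 * (if i = j then 1 else 0) = 0"
    using assms(2) unfolding lyapunov_equation_def by fastforce
qed

text \<open>Among the vertices of rank at most that of \<open>i\<close>, the vertex \<open>i\<close>
  is a sink, so column \<open>i\<close> of \<open>M\<close> has only its diagonal entry there. If
  \<open>S y\<close> is the unit vector at \<open>i\<close>, the quadratic form gives
  \<open>y i * M (i, i) < 0\<close>, while \<open>y i\<close> is the form of \<open>S\<close> at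
  \<open>y\<close>.\<close>

lemma triangular_lyapunov_diag_neg:
  fixes rank :: "'v \<Rightarrow> nat"
  assumes "finite V" "pos_def V S" "lyapunov_equation V M S" "i \<in> V"
    and "\<And>a b. a \<in> V \<Longrightarrow> b \<in> V \<Longrightarrow> a \<noteq> b \<Longrightarrow> M (b, a) \<noteq> 0 \<Longrightarrow> rank a < rank b"
  shows "M (i, i) < 0"
proof -
  define A where "A = {k \<in> V. rank k \<le> rank i}"
  have A: "A \<subseteq> V" "i \<in> A" "finite A" using assms(1,4) by (auto simp: A_def)
  have "lyapunov_equation A M S"
  proof (rule lyapunov_equation_ancestral[OF assms(1,3) A(1)])
    fix a k assume ak: "a \<in> A" "k \<in> V" "M (a, k) \<noteq> 0"
    then show "k \<in> A" using assms(5)[of k a] by (cases "k = a") (auto simp: A_def)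
  qed
  moreover have pd: "pos_def A S" using pos_def_subset assms(1,2) A(1) by blast
  obtain y where y: "\<And>j. j \<in> A \<Longrightarrow> (\<Sum>k\<in>A. S (j, k) * y k) = (if j = i then 1 else 0)"
    using pos_def_solve[OF A(3) pd, of "\<lambda>j. if j = i then 1 else 0"] by blast
  ultimately have "(\<Sum>a\<in>A. y a * (\<Sum>k\<in>A. M (a, k) * (if k = i then 1 else 0))) = - (\<Sum>a\<in>A. y a * y a)"
    using lyapunov_quadratic_form[where V = A and S = S and M = M and y = y] A(3) pos_def_sym[OF pd]
    by (simp cong: sum.cong)
  moreover have "(\<Sum>k\<in>A. M (a, k) * (if k = i then 1 else 0)) = M (a, i)" for a
    using A by (simp add: if_distrib[of "(*) _"] cong: if_cong)
  moreover have "(\<Sum>a\<in>A. y a * M (a, i)) = y i * M (i, i)"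
  proof -
    have "M (a, i) = 0" if "a \<in> A" "a \<noteq> i" for a
      using assms(5)[of i a] that assms(4) by (auto simp: A_def)
    then have "(\<Sum>a\<in>A. y a * M (a, i)) = (\<Sum>a\<in>A. if a = i then y i * M (i, i) else 0)"
      by (intro sum.cong) auto
    then show ?thesis using A by simp
  qed
  ultimately have eq: "y i * M (i, i) = - (\<Sum>a\<in>A. y a * y a)" by simp
  have "\<exists>k\<in>A. y k \<noteq> 0"
  proof (rule ccontr)
    assume "\<not> ?thesis"
    then have "(\<Sum>k\<in>A. S (i, k) * y k) = 0" by (intro sum.neutral ballI) auto
    then show False using y[OF A(2)] by simp
  qed
  then obtain k where k: "k \<in> A" "y k \<noteq> 0" by blast
  have "0 < (\<Sum>a\<in>A. \<Sum>b\<in>A. y a * S (a, b) * y b)" using pd k by (rule pos_def_pos)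
  also have "\<dots> = (\<Sum>a\<in>A. y a * (if a = i then 1 else 0))"
    by (intro sum.cong refl) (simp only: y[symmetric] sum_distrib_left mult.assoc)
  also have "\<dots> = y i" using A by (simp add: if_distrib[of "(*) _"] cong: if_cong)
  finally have "y i > 0" .
  moreover have "(\<Sum>a\<in>A. y a * y a) > 0"
    using k A(3) by (intro sum_pos2[of A k]) (auto simp: zero_less_mult_iff)
  ultimately show ?thesis using eq by (metis mult_less_0_iff neg_less_0_iff_less not_less_iff_gr_or_eq)
qed

text \<open>Induction along ranks: at \<open>(x, y)\<close> all other terms of the equation contain
  the covariance of a proper parent of \<open>x\<close> or \<open>y\<close>, which is zero. There
  remains \<open>(M (x, x) + M (y, y)) * S (x, y) = 0\<close> with negative diagonal
  entries.\<close>

lemma lyapunov_ancestral_disjoint_zero: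
  fixes rank :: "'v \<Rightarrow> nat"
  assumes "finite V" "pos_def V S" "lyapunov_equation V M S"
    and rank: "\<And>a b. a \<in> V \<Longrightarrow> b \<in> V \<Longrightarrow> a \<noteq> b \<Longrightarrow> M (b, a) \<noteq> 0 \<Longrightarrow> rank a < rank b"
    and X: "X \<subseteq> V" "\<And>a k. a \<in> X \<Longrightarrow> k \<in> V \<Longrightarrow> M (a, k) \<noteq> 0 \<Longrightarrow> k \<in> X"
    and Y: "Y \<subseteq> V" "\<And>a k. a \<in> Y \<Longrightarrow> k \<in> V \<Longrightarrow> M (a, k) \<noteq> 0 \<Longrightarrow> k \<in> Y"
    and disj: "X \<inter> Y = {}" and "x \<in> X" "y \<in> Y"
  shows "S (x, y) = 0"
  using \<open>x \<in> X\<close> \<open>y \<in> Y\<close>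
proof (induction "rank x + rank y" arbitrary: x y rule: less_induct)
  case less
  have V: "x \<in> V" "y \<in> V" "x \<noteq> y" using less.prems X(1) Y(1) disj by auto
  have "(\<Sum>k\<in>V. M (x, k) * S (k, y)) = (\<Sum>k\<in>V. if k = x then M (x, x) * S (x, y) else 0)"
  proof (intro sum.cong refl)
    fix k assume k: "k \<in> V"
    have "M (x, k) * S (k, y) = 0" if "k \<noteq> x"
    proof (cases "M (x, k) = 0")
      case False
      then have "S (k, y) = 0"
        using rank[OF k V(1) that] X(2)[OF less.prems(1) k] less.prems(2) by (intro less.hyps) auto
      then show ?thesis by simp
    qed simp
    then show "M (x, k) * S (k, y) = (if k = x then M (x, x) * S (x, y) else 0)" by simp
  qed
  moreover have "(\<Sum>k\<in>V. S (x, k) * M (y, k)) = (\<Sum>k\<in>V. if k = y then S (x, y) * M (y, y) else 0)"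
  proof (intro sum.cong refl)
    fix k assume k: "k \<in> V"
    have "S (x, k) * M (y, k) = 0" if "k \<noteq> y"
    proof (cases "M (y, k) = 0")
      case False
      then have "S (x, k) = 0"
        using rank[OF k V(2) that] Y(2)[OF less.prems(2) k] less.prems(1) by (intro less.hyps) auto
      then show ?thesis by simp
    qed simp
    then show "S (x, k) * M (y, k) = (if k = y then S (x, y) * M (y, y) else 0)" by simp
  qed
  moreover have "(\<Sum>k\<in>V. M (x, k) * S (k, y)) + (\<Sum>k\<in>V. S (x, k) * M (y, k)) = 0"
    using assms(3) V unfolding lyapunov_equation_def by fastforce
  ultimately have "(M (x, x) + M (y, y)) * S (x, y) = 0"
    using V assms(1) by (simp add: algebra_simps)
  moreover have "M (x, x) < 0"
    by (rule triangular_lyapunov_diag_neg[OF assms(1-3) V(1), of rank]) (rule rank)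
  moreover have "M (y, y) < 0"
    by (rule triangular_lyapunov_diag_neg[OF assms(1-3) V(2), of rank]) (rule rank)
  ultimately show ?case by auto
qed

section \<open>Reversing one edge in a fixed covariance\<close>

text \<open>The correction of \<open>M\<close> touches only columns in \<open>B\<close>, and only
  rows that are \<open>i\<close>, \<open>j\<close> or outside \<open>B \<union> Q\<close>. The
  hypotheses on edges allow all these entries, up to the edge being reversed.\<close>

lemma cov_model_flip_subset:
  fixes rank :: "'v \<Rightarrow> nat"
  assumes fin: "finite V"
    and rank: "\<And>u v. u \<in> V \<Longrightarrow> v \<in> V \<Longrightarrow> (u, v) \<in> E \<Longrightarrow> u \<noteq> v \<Longrightarrow> rank u < rank v"
    and B: "B \<subseteq> V" "\<And>u b. u \<in> V \<Longrightarrow> b \<in> B \<Longrightarrow> (u, b) \<in> E \<Longrightarrow> u \<in> B"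
    and Q: "Q \<subseteq> V - B" "\<And>u q. u \<in> V \<Longrightarrow> q \<in> Q \<Longrightarrow> (u, q) \<in> E \<Longrightarrow> u \<in> Q"
    and ij: "i \<in> B" "j \<in> B" "i \<noteq> j"
    and edges: "\<And>u r. u \<in> B \<Longrightarrow> r \<in> V - B - Q \<Longrightarrow> (u, r) \<in> E"
      "\<And>u. u \<in> B \<Longrightarrow> u \<noteq> j \<Longrightarrow> (u, i) \<in> E" "\<And>u. u \<in> B \<Longrightarrow> (u, j) \<in> E"
  shows "cov_model V E \<subseteq> cov_model V (insert (j, i) (E - {(i, j)}))"
proof
  fix S assume "S \<in> cov_model V E"
  then obtain M where S: "S \<in> real_matrices V" "pos_def V S" and M: "lyapunov_equation V M S"
    "\<And>i j. i \<in> V \<Longrightarrow> j \<in> V \<Longrightarrow> (i, j) \<notin> E \<Longrightarrow> M (j, i) = 0"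
    by (elim cov_modelE) blast
  note sym = pos_def_sym[OF S(2)]
  have finB: "finite B" and pdB: "pos_def B S"
    using fin B(1) finite_subset pos_def_subset[OF S(2) B(1) fin] by auto
  have zero: "S (q, b) = 0" if "q \<in> Q" "b \<in> B" for q b
  proof (rule lyapunov_ancestral_disjoint_zero[OF fin S(2) M(1), of rank Q B])
    show "rank u < rank v" if "u \<in> V" "v \<in> V" "u \<noteq> v" "M (v, u) \<noteq> 0" for u v
      using rank M(2) that by blast
    show "k \<in> Q" if "a \<in> Q" "k \<in> V" "M (a, k) \<noteq> 0" for a k using Q M(2) that by blast
    show "k \<in> B" if "a \<in> B" "k \<in> V" "M (a, k) \<noteq> 0" for a k using B M(2) that by blast
  qed (use Q B that in auto)
  \<comment> \<open>For \<open>c\<close> in \<open>B\<close> this is column \<open>c\<close> of the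
    inverse of the block of \<open>S\<close> on \<open>B\<close>, extended by zero.\<close>
  have "\<exists>p. (\<forall>b\<in>B. (\<Sum>k\<in>V. S (b, k) * p k) = (if b = c then 1 else 0)) \<and> (\<forall>k. k \<notin> B \<longrightarrow> p k = 0)" for c
  proof -
    obtain p where p: "\<And>b. b \<in> B \<Longrightarrow> (\<Sum>k\<in>B. S (b, k) * p k) = (if b = c then 1 else 0)"
      using pos_def_solve[OF finB pdB, of "\<lambda>b. if b = c then 1 else 0"] by blast
    have "(\<Sum>k\<in>V. S (b, k) * (if k \<in> B then p k else 0)) = (\<Sum>k\<in>B. S (b, k) * p k)" for b
      by (rule sum.mono_neutral_cong_right) (use fin B in auto)
    then show ?thesis using p by (intro exI[of _ "\<lambda>k. if k \<in> B then p k else 0"]) auto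
  qed
  then obtain p where p: "\<And>c b. b \<in> B \<Longrightarrow> (\<Sum>k\<in>V. S (b, k) * p c k) = (if b = c then 1 else 0)"
    "\<And>c k. k \<notin> B \<Longrightarrow> p c k = 0" by metis
  define f where "f = (\<lambda>c r. \<Sum>k\<in>V. S (r, k) * p c k)"
  have fB: "f c b = (if b = c then 1 else 0)" if "b \<in> B" for b c using p(1)[OF that] by (simp add: f_def)
  have fQ: "f c q = 0" if "q \<in> Q" for q c
    unfolding f_def by (intro sum.neutral ballI) (use zero[OF that] p(2) in \<open>metis mult_eq_0_iff\<close>)
  have f': "(\<Sum>k\<in>V. p c k * S (k, r)) = f c r" if "r \<in> V" for c r
    unfolding f_def using that by (intro sum.cong refl) (simp add: sym mult.commute)
  \<comment> \<open>\<open>p i i\<close> is the quadratic form of \<open>S\<close> at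
    \<open>p i\<close>, because \<open>f i\<close> is a unit vector on \<open>B\<close>.\<close>
  have "p i i > 0"
  proof -
    have "p i i \<noteq> 0 \<or> (\<exists>k\<in>V. p i k \<noteq> 0)"
    proof (rule ccontr)
      assume "\<not> ?thesis"
      then have "f i i = 0" unfolding f_def by (intro sum.neutral ballI) auto
      then show False using fB[OF ij(1)] by simp
    qed
    then obtain k where k: "k \<in> V" "p i k \<noteq> 0" using ij B by blast
    have "0 < (\<Sum>a\<in>V. \<Sum>b\<in>V. p i a * S (a, b) * p i b)" using S(2) k by (rule pos_def_pos)
    also have "\<dots> = (\<Sum>a\<in>V. p i a * f i a)" by (simp add: f_def sum_distrib_left mult.assoc)
    also have "\<dots> = (\<Sum>a\<in>V. if a = i then p i i else 0)"
      using fB p(2) by (intro sum.cong refl) (metis mult.right_neutral mult_zero_left mult_zero_right)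
    also have "\<dots> = p i i" using fin ij B by auto
    finally show ?thesis .
  qed
  \<comment> \<open>Cancels the entry of the removed edge:
    \<open>N (j, i) = M (j, i) - a * p i i\<close>.\<close>
  define a where "a = M (j, i) / p i i"
  \<comment> \<open>The correction times \<open>S\<close> is \<open>a (f\<^sub>i f\<^sub>j\<^sup>T - f\<^sub>j f\<^sub>i\<^sup>T)\<close>, hence skew-symmetric.\<close>
  define N where "N = (\<lambda>(r, u). M (r, u) + a * (f i r * p j u - f j r * p i u))"
  have N: "N (r, u) = M (r, u) + a * (f i r * p j u - f j r * p i u)" for r u by (simp add: N_def)
  have NS: "(\<Sum>k\<in>V. N (r, k) * S (k, s)) = (\<Sum>k\<in>V. M (r, k) * S (k, s)) + a * (f i r * f j s - f j r * f i s)"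
    if "s \<in> V" for r s
  proof -
    have "(\<Sum>k\<in>V. N (r, k) * S (k, s)) = (\<Sum>k\<in>V. M (r, k) * S (k, s) +
        a * (f i r * (p j k * S (k, s)) - f j r * (p i k * S (k, s))))"
      by (intro sum.cong refl) (simp add: N algebra_simps)
    also have "\<dots> = (\<Sum>k\<in>V. M (r, k) * S (k, s)) + a * (f i r * (\<Sum>k\<in>V. p j k * S (k, s)) - f j r * (\<Sum>k\<in>V. p i k * S (k, s)))"
      by (simp only: sum.distrib sum_subtractf flip: sum_distrib_left)
    finally show ?thesis using f'[OF that] by simp
  qed
  show "S \<in> cov_model V (insert (j, i) (E - {(i, j)}))"
  proof (rule cov_modelI[OF S])
    show "lyapunov_equation V N S" unfolding lyapunov_equation_def
    proof (intro ballI)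
      fix r s assume rs: "r \<in> V" "s \<in> V"
      have tr: "(\<Sum>k\<in>V. S (r, k) * L (s, k)) = (\<Sum>k\<in>V. L (s, k) * S (k, r))" for L :: "'v \<times> 'v \<Rightarrow> real"
        using rs by (intro sum.cong refl) (simp add: sym mult.commute)
      have "(\<Sum>k\<in>V. M (r, k) * S (k, s)) + (\<Sum>k\<in>V. S (r, k) * M (s, k)) + 2 * (if r = s then 1 else 0) = 0"
        using M(1) rs unfolding lyapunov_equation_def by blast
      then show "(\<Sum>k\<in>V. N (r, k) * S (k, s)) + (\<Sum>k\<in>V. S (r, k) * N (s, k)) + 2 * (if r = s then 1 else 0) = 0"
        unfolding tr NS[OF rs(1)] NS[OF rs(2)] by (simp add: algebra_simps)
    qed
  next
    fix u r assume u: "u \<in> V" and r: "r \<in> V" and ne: "(u, r) \<notin> insert (j, i) (E - {(i, j)})"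
    show "N (r, u) = 0"
    proof (cases "(u, r) = (i, j)")
      case True
      then show ?thesis using ij \<open>p i i > 0\<close> fB by (simp add: N a_def)
    next
      case False
      with ne have nE: "(u, r) \<notin> E" "(u, r) \<noteq> (j, i)" by auto
      then have "M (r, u) = 0" using M(2) u r by blast
      moreover have "f i r * p j u = 0 \<and> f j r * p i u = 0"
      proof (cases "u \<in> B")
        case True
        \<comment> \<open>Rows outside \<open>B \<union> Q\<close> and the rows \<open>i\<close>,
          \<open>j\<close> receive edges from \<open>u\<close>, so \<open>r\<close> is none of them
          and \<open>f i r = f j r = 0\<close>.\<close>
        then have "r \<in> B \<or> r \<in> Q" "r \<noteq> i" "r \<noteq> j" using edges nE r by auto
        then show ?thesis using fB fQ by auto
      qed (simp add: p(2))
      ultimately show ?thesis by (auto simp: N)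
    qed
  qed
qed

section \<open>Separating small graphs\<close>

text \<open>The form is a sum of squares weighted by \<open>d\<close>. As \<open>l\<close> is lower
  unitriangular, the square at the last index \<open>k\<close> with \<open>x k \<noteq> 0\<close> is
  that of \<open>x k\<close>.\<close>

lemma pos_def_LDL:
  fixes l :: "nat \<Rightarrow> nat \<Rightarrow> real"
  assumes "\<And>k. k < n \<Longrightarrow> d k > 0" "\<And>i. i < n \<Longrightarrow> l i i = 1" "\<And>i k. i < k \<Longrightarrow> k < n \<Longrightarrow> l i k = 0"
    and "\<And>i j. i < n \<Longrightarrow> j < n \<Longrightarrow> s (i, j) = (\<Sum>k<n. l i k * d k * l j k)"
  shows "pos_def {..<n} s"
  unfolding pos_def_def
proof (intro conjI ballI allI impI)
  fix i j assume "i \<in> {..<n}" "j \<in> {..<n}"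
  then show "s (i, j) = s (j, i)" using assms(4) by (simp add: mult.commute mult.left_commute)
next
  fix x :: "nat \<Rightarrow> real" assume "\<exists>i\<in>{..<n}. x i \<noteq> 0"
  then have ne: "{i. i < n \<and> x i \<noteq> 0} \<noteq> {}" (is "?A \<noteq> {}") by auto
  define k where "k = Max ?A"
  have fin: "finite ?A" by simp
  have "k \<in> ?A" unfolding k_def using fin ne by (rule Max_in)
  then have k: "k < n" "x k \<noteq> 0" by auto
  have above: "x i = 0" if "k < i" "i < n" for i
    using Max_ge[OF fin, of i] that unfolding k_def by fastforce
  have "(\<Sum>i<n. x i * l i k) = (\<Sum>i<n. if i = k then x k else 0)"
  proof (intro sum.cong refl)
    fix i assume "i \<in> {..<n}"
    then show "x i * l i k = (if i = k then x k else 0)"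
      using above[of i] assms(2)[of k] assms(3)[of i k] k by (cases i k rule: linorder_cases) auto
  qed
  then have row: "(\<Sum>i<n. x i * l i k) = x k" using k by simp
  have "(\<Sum>i<n. \<Sum>j<n. x i * s (i, j) * x j) = (\<Sum>i<n. \<Sum>j<n. \<Sum>k<n. d k * ((x i * l i k) * (x j * l j k)))"
    by (intro sum.cong refl) (simp add: assms(4) sum_distrib_left sum_distrib_right algebra_simps)
  also have "\<dots> = (\<Sum>i<n. \<Sum>k<n. \<Sum>j<n. d k * ((x i * l i k) * (x j * l j k)))"
    by (intro sum.cong refl sum.swap)
  also have "\<dots> = (\<Sum>k<n. \<Sum>i<n. \<Sum>j<n. d k * ((x i * l i k) * (x j * l j k)))"
    by (rule sum.swap)
  also have "\<dots> = (\<Sum>k<n. d k * (\<Sum>i<n. x i * l i k)\<^sup>2)"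
    by (simp only: power2_eq_square sum_product) (simp only: sum_distrib_left)
  also have "\<dots> > 0"
    using k row assms(1) by (intro sum_pos2[of _ k]) (auto intro!: mult_nonneg_nonneg simp: less_imp_le)
  finally show "(\<Sum>i\<in>{..<n}. \<Sum>j\<in>{..<n}. x i * s (i, j) * x j) > 0" .
qed

text \<open>Vertices are numbered by \<open>x\<close>, so that one concrete covariance
  \<open>s\<close> serves all choices of vertices.\<close>

lemma cov_model_eq_transfer:
  assumes inj: "inj_on x {..<n::nat}"
    and eq: "cov_model (x ` {..<n}) E = cov_model (x ` {..<n}) F"
    and E: "\<And>i j. i < n \<Longrightarrow> j < n \<Longrightarrow> (x i, x j) \<notin> E \<Longrightarrow> m (j, i) = 0"
    and s: "pos_def {..<n} s" "lyapunov_equation {..<n} m s"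
  obtains t where "\<And>i j. i < n \<Longrightarrow> j < n \<Longrightarrow> (x i, x j) \<notin> F \<Longrightarrow> t (j, i) = 0"
    and "lyapunov_equation {..<n} t s"
proof -
  define K where "K = x ` {..<n}"
  define y where "y = inv_into {..<n} x"
  have yx: "y (x i) = i" if "i < n" for i using inj that by (simp add: y_def)
  define S where "S = (\<lambda>(a, b) \<in> K \<times> K. s (y a, y b))"
  define M where "M = (\<lambda>(a, b). m (y a, y b))"
  have S: "S (x i, x j) = s (i, j)" if "i < n" "j < n" for i j
    using that by (simp add: S_def K_def yx)
  have M: "M (x i, x j) = m (i, j)" if "i < n" "j < n" for i j
    using that by (simp add: M_def yx)
  have sum: "(\<Sum>a\<in>K. g a) = (\<Sum>i<n. g (x i))" for g :: "'a \<Rightarrow> real"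
    unfolding K_def using inj by (simp add: sum.reindex)
  have lyap: "lyapunov_equation K N S \<longleftrightarrow> lyapunov_equation {..<n} (\<lambda>(i, j). N (x i, x j)) s" for N
  proof -
    have "(\<Sum>k<n. N (x i, x k) * S (x k, x j)) = (\<Sum>k<n. N (x i, x k) * s (k, j))"
      "(\<Sum>k<n. S (x i, x k) * N (x j, x k)) = (\<Sum>k<n. s (i, k) * N (x j, x k))"
      "x i = x j \<longleftrightarrow> i = j" if "i < n" "j < n" for i j
      using that inj by (auto simp: S inj_on_eq_iff intro!: sum.cong)
    then show ?thesis unfolding lyapunov_equation_def sum by (simp add: K_def)
  qed
  have "pos_def K S"
    unfolding pos_def_def
  proof (intro conjI ballI allI impI)
    fix a b assume "a \<in> K" "b \<in> K"
    then show "S (a, b) = S (b, a)" using pos_def_sym[OF s(1)] by (auto simp: K_def S)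
  next
    fix u :: "'a \<Rightarrow> real" assume "\<exists>a\<in>K. u a \<noteq> 0"
    then obtain i where "i < n" "u (x i) \<noteq> 0" by (auto simp: K_def)
    then have "0 < (\<Sum>i<n. \<Sum>j<n. u (x i) * s (i, j) * u (x j))"
      using pos_def_pos[OF s(1), of i "\<lambda>i. u (x i)"] by simp
    also have "\<dots> = (\<Sum>i<n. \<Sum>j<n. u (x i) * S (x i, x j) * u (x j))"
      by (intro sum.cong refl) (simp add: S)
    finally show "(\<Sum>a\<in>K. \<Sum>b\<in>K. u a * S (a, b) * u b) > 0" by (simp add: sum)
  qed
  moreover have "lyapunov_equation K M S"
    unfolding lyap using s(2)
    by (subst lyapunov_equation_cong[of _ _ m _ s]) (auto simp: M)
  moreover have "S \<in> real_matrices K" by (auto simp: S_def real_matrices_def)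
  moreover have "M (b, a) = 0" if "a \<in> K" "b \<in> K" "(a, b) \<notin> E" for a b
    using that E by (auto simp: K_def M)
  ultimately have "S \<in> cov_model K E" by (intro cov_modelI)
  then have "S \<in> cov_model K F" using eq by (simp add: K_def)
  then obtain N where "lyapunov_equation K N S" "\<And>a b. a \<in> K \<Longrightarrow> b \<in> K \<Longrightarrow> (a, b) \<notin> F \<Longrightarrow> N (b, a) = 0"
    by (elim cov_modelE) blast
  then show ?thesis using that[of "\<lambda>(i, j). N (x i, x j)"] unfolding lyap by (auto simp: K_def)
qed

text \<open>
  The factorisation \<open>s = l diag(d) l\<^sup>T\<close> certifies positive definiteness. Two models are separated by
  choosing the numbers such that the linear equations for \<open>t\<close> are inconsistent.
\<close>

lemma cov_model_eq_certificate:
  fixes xs :: "'v list" and m s l :: "real list list" and d :: "real list"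
  assumes "distinct xs" "length xs = n" "cov_model (set xs) E = cov_model (set xs) F"
    and "\<forall>i<n. \<forall>j<n. m ! j ! i \<noteq> 0 \<longrightarrow> (xs ! i, xs ! j) \<in> E"
    and "\<forall>k<n. d ! k > 0" "\<forall>i<n. l ! i ! i = 1" "\<forall>k<n. \<forall>i<k. l ! i ! k = 0"
    and "\<forall>i<n. \<forall>j<n. s ! i ! j = (\<Sum>k<n. l ! i ! k * d ! k * l ! j ! k)"
    and "lyapunov_equation {..<n} (\<lambda>(i, j). m ! i ! j) (\<lambda>(i, j). s ! i ! j)"
  shows "\<exists>t. (\<forall>i<n. \<forall>j<n. (xs ! i, xs ! j) \<notin> F \<longrightarrow> t (j, i) = 0) \<and>
    lyapunov_equation {..<n} t (\<lambda>(i, j). s ! i ! j)"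
proof (rule cov_model_eq_transfer[of "(!) xs" n E F "\<lambda>(i, j). m ! i ! j" "\<lambda>(i, j). s ! i ! j"])
  show "inj_on ((!) xs) {..<n}" using assms(1,2) by (simp add: inj_on_nth)
  have "(!) xs ` {..<n} = set xs" using assms(2) by (auto simp: set_conv_nth)
  then show "cov_model ((!) xs ` {..<n}) E = cov_model ((!) xs ` {..<n}) F" using assms(3) by simp
  show "pos_def {..<n} (\<lambda>(i, j). s ! i ! j)"
    by (rule pos_def_LDL[of n "(!) d" "\<lambda>i k. l ! i ! k"]) (use assms(5-8) in auto)
  show "(\<lambda>(i, j). m ! i ! j) (j, i) = 0" if "i < n" "j < n" "(xs ! i, xs ! j) \<notin> E" for i j
    using assms(4) that by auto
qed (use assms(9) in blast)+

lemmas certificate_simps = numeral_eq_Suc All_less_Suc lessThan_Suc lyapunov_equation_def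

section \<open>Separations on two, three and four vertices\<close>

text \<open>For \<open>F\<close> the matrix \<open>t\<close> is diagonal. The variances make its
  entries negative, and a nonzero covariance of \<open>a\<close> and \<open>b\<close> is then
  impossible.\<close>

lemma cov_model_neq_edge:
  assumes "distinct [a, b]" "{(a, a), (b, b)} \<subseteq> E"
    and "{(a, b)} \<subseteq> E"
    and "(a, b) \<notin> F" "(b, a) \<notin> F"
  shows "cov_model {a, b} E \<noteq> cov_model {a, b} F"
proof
  let ?s = "[[1, 1], [1, 3]]"
  assume eq: "cov_model {a, b} E = cov_model {a, b} F"
  have "\<exists>t. (\<forall>i<2. \<forall>j<2. ([a, b] ! i, [a, b] ! j) \<notin> F \<longrightarrow> t (j, i) = 0) \<and>
      lyapunov_equation {..<2} t (\<lambda>(i, j). ?s ! i ! j)"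
    by (rule cov_model_eq_certificate[where E = E and m = "[[-1, 0], [2, -1]]"
        and l = "[[1, 0], [1, 1]]" and d = "[1, 2]"])
      (use assms(1-3) eq in \<open>simp_all add: certificate_simps\<close>)
  then obtain t where "\<forall>i<2. \<forall>j<2. ([a, b] ! i, [a, b] ! j) \<notin> F \<longrightarrow> t (j, i) = 0"
      "lyapunov_equation {..<2} t (\<lambda>(i, j). ?s ! i ! j)" by blast
  with assms(4-) show False by (simp add: certificate_simps; elim conjE; linarith)
qed

text \<open>Used when \<open>b -> c\<close> is reversed. In \<open>F\<close>, \<open>c\<close> has
  no parent among these vertices; with \<open>a\<close> also parentless the two would be
  uncorrelated, and with \<open>b -> a\<close> the chosen numbers clash.\<close>

lemma cov_model_neq_chain:
  assumes "distinct [a, b, c]" "{(a, a), (b, b), (c, c)} \<subseteq> E"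
    and "{(a, b), (b, c)} \<subseteq> E"
    and "(b, c) \<notin> F" "(a, c) \<notin> F" "(c, a) \<notin> F"
    and "(a, b) \<notin> F \<or> (b, a) \<notin> F"
  shows "cov_model {a, b, c} E \<noteq> cov_model {a, b, c} F"
proof
  let ?s = "[[1, 1, 1], [1, 3, 4], [1, 4, 9]]"
  assume eq: "cov_model {a, b, c} E = cov_model {a, b, c} F"
  have "\<exists>t. (\<forall>i<3. \<forall>j<3. ([a, b, c] ! i, [a, b, c] ! j) \<notin> F \<longrightarrow> t (j, i) = 0) \<and>
      lyapunov_equation {..<3} t (\<lambda>(i, j). ?s ! i ! j)"
    by (rule cov_model_eq_certificate[where E = E and m = "[[-1, 0, 0], [2, -1, 0], [0, 2, -1]]"
        and l = "[[1, 0, 0], [1, 1, 0], [1, 3/2, 1]]" and d = "[1, 2, 7/2]"])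
      (use assms(1-3) eq in \<open>simp_all add: certificate_simps\<close>)
  then obtain t where "\<forall>i<3. \<forall>j<3. ([a, b, c] ! i, [a, b, c] ! j) \<notin> F \<longrightarrow> t (j, i) = 0"
      "lyapunov_equation {..<3} t (\<lambda>(i, j). ?s ! i ! j)" by blast
  note t = this
  from assms(7) show False
  proof
    assume "(a, b) \<notin> F"
    with t assms(4-6) show False by (simp add: certificate_simps; elim conjE; linarith)
  next
    assume "(b, a) \<notin> F"
    with t assms(4-6) show False by (simp add: certificate_simps; elim conjE; linarith)
  qed
qed

text \<open>Used when \<open>a -> b\<close> is reversed. In \<open>F\<close>, \<open>b\<close> has
  no parent among these vertices; with \<open>c\<close> also parentless the two would be
  uncorrelated, and along \<open>b -> a -> c\<close> the chosen numbers clash.\<close>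

lemma cov_model_neq_fork:
  assumes "distinct [a, b, c]" "{(a, a), (b, b), (c, c)} \<subseteq> E"
    and "{(a, b), (a, c)} \<subseteq> E"
    and "(a, b) \<notin> F" "(b, c) \<notin> F" "(c, b) \<notin> F"
    and "(a, c) \<notin> F \<or> (c, a) \<notin> F"
  shows "cov_model {a, b, c} E \<noteq> cov_model {a, b, c} F"
proof
  let ?s = "[[1, 1, 1], [1, 3, 2], [1, 2, 3]]"
  assume eq: "cov_model {a, b, c} E = cov_model {a, b, c} F"
  have "\<exists>t. (\<forall>i<3. \<forall>j<3. ([a, b, c] ! i, [a, b, c] ! j) \<notin> F \<longrightarrow> t (j, i) = 0) \<and>
      lyapunov_equation {..<3} t (\<lambda>(i, j). ?s ! i ! j)"
    by (rule cov_model_eq_certificate[where E = E and m = "[[-1, 0, 0], [2, -1, 0], [2, 0, -1]]"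
        and l = "[[1, 0, 0], [1, 1, 0], [1, 1/2, 1]]" and d = "[1, 2, 3/2]"])
      (use assms(1-3) eq in \<open>simp_all add: certificate_simps\<close>)
  then obtain t where "\<forall>i<3. \<forall>j<3. ([a, b, c] ! i, [a, b, c] ! j) \<notin> F \<longrightarrow> t (j, i) = 0"
      "lyapunov_equation {..<3} t (\<lambda>(i, j). ?s ! i ! j)" by blast
  note t = this
  from assms(7) show False
  proof
    assume "(a, c) \<notin> F"
    with t assms(4-6) show False by (simp add: certificate_simps; elim conjE; linarith)
  next
    assume "(c, a) \<notin> F"
    with t assms(4-6) show False by (simp add: certificate_simps; elim conjE; linarith)
  qed
qed

lemma cov_model_neq_through:
  assumes "distinct [a, b, c, d]" "{(a, a), (b, b), (c, c), (d, d)} \<subseteq> E"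
    and "{(a, b), (a, c), (b, c), (b, d), (c, d)} \<subseteq> E"
    and "(b, c) \<notin> F" "(b, a) \<notin> F" "(c, a) \<notin> F" "(d, b) \<notin> F" "(d, c) \<notin> F" "(a, d) \<notin> F" "(d, a) \<notin> F"
  shows "cov_model {a, b, c, d} E \<noteq> cov_model {a, b, c, d} F"
proof
  \<comment> \<open>The weights 2 and -2 of \<open>b -> d\<close> and \<open>c -> d\<close> make
    \<open>d\<close> uncorrelated with \<open>a\<close> and \<open>b\<close>, but not with
    \<open>c\<close>. This forces \<open>t (1, 2) = 0\<close>, the entry of \<open>c -> b\<close>,
    and then the block on \<open>a\<close>, \<open>b\<close>, \<open>c\<close> fits no
    \<open>t\<close>.\<close>
  let ?s = "[[1, 1, 1, 0], [1, 3, 3, 0], [1, 3, 5, -2], [0, 0, -2, 5]]"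
  assume eq: "cov_model {a, b, c, d} E = cov_model {a, b, c, d} F"
  have "\<exists>t. (\<forall>i<4. \<forall>j<4. ([a, b, c, d] ! i, [a, b, c, d] ! j) \<notin> F \<longrightarrow> t (j, i) = 0) \<and>
      lyapunov_equation {..<4} t (\<lambda>(i, j). ?s ! i ! j)"
    by (rule cov_model_eq_certificate[where E = E and m = "[[-1, 0, 0, 0], [2, -1, 0, 0], [1, 1, -1, 0], [0, 2, -2, -1]]"
        and l = "[[1, 0, 0, 0], [1, 1, 0, 0], [1, 1, 1, 0], [0, 0, -1, 1]]" and d = "[1, 2, 2, 3]"])
      (use assms(1-3) eq in \<open>simp_all add: certificate_simps\<close>)
  then obtain t where "\<forall>i<4. \<forall>j<4. ([a, b, c, d] ! i, [a, b, c, d] ! j) \<notin> F \<longrightarrow> t (j, i) = 0"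
      "lyapunov_equation {..<4} t (\<lambda>(i, j). ?s ! i ! j)" by blast
  with assms(4-) show False by (simp add: certificate_simps; elim conjE; linarith)
qed

lemma cov_model_neq_parent_child:
  assumes "distinct [a, b, c, d]" "{(a, a), (b, b), (c, c), (d, d)} \<subseteq> E"
    and "{(a, b), (a, c), (b, c), (a, d)} \<subseteq> E"
    and "(b, c) \<notin> F" "(b, a) \<notin> F" "(c, a) \<notin> F" "(d, a) \<notin> F" "(b, d) \<notin> F" "(d, b) \<notin> F" "(c, d) \<notin> F" "(d, c) \<notin> F"
  shows "cov_model {a, b, c, d} E \<noteq> cov_model {a, b, c, d} F"
proof
  \<comment> \<open>The direct effect of \<open>a\<close> on \<open>c\<close> cancels the one
    through \<open>b\<close>. The zero covariance forces \<open>t (2, 0) = 0\<close>, so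
    \<open>c\<close> is not influenced by \<open>a\<close>, although its covariance with
    \<open>d\<close> is 1/2.\<close>
  let ?s = "[[1, 1, 0, 1], [1, 3, 1, 2], [0, 1, 2, 1/2], [1, 2, 1/2, 3]]"
  assume eq: "cov_model {a, b, c, d} E = cov_model {a, b, c, d} F"
  have "\<exists>t. (\<forall>i<4. \<forall>j<4. ([a, b, c, d] ! i, [a, b, c, d] ! j) \<notin> F \<longrightarrow> t (j, i) = 0) \<and>
      lyapunov_equation {..<4} t (\<lambda>(i, j). ?s ! i ! j)"
    by (rule cov_model_eq_certificate[where E = E and m = "[[-1, 0, 0, 0], [2, -1, 0, 0], [-1, 1, -1, 0], [2, 0, 0, -1]]"
        and l = "[[1, 0, 0, 0], [1, 1, 0, 0], [0, 1/2, 1, 0], [1, 1/2, 0, 1]]" and d = "[1, 2, 3/2, 3/2]"])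
      (use assms(1-3) eq in \<open>simp_all add: certificate_simps\<close>)
  then obtain t where "\<forall>i<4. \<forall>j<4. ([a, b, c, d] ! i, [a, b, c, d] ! j) \<notin> F \<longrightarrow> t (j, i) = 0"
      "lyapunov_equation {..<4} t (\<lambda>(i, j). ?s ! i ! j)" by blast
  with assms(4-) show False by (simp add: certificate_simps; elim conjE; linarith)
qed

lemma cov_model_neq_grandparent:
  assumes "distinct [a, b, c, d]" "{(a, a), (b, b), (c, c), (d, d)} \<subseteq> E"
    and "{(a, b), (b, c), (b, d), (c, d)} \<subseteq> E"
    and "(c, d) \<notin> F" "(b, a) \<notin> F" "(c, b) \<notin> F" "(d, b) \<notin> F" "(a, c) \<notin> F" "(c, a) \<notin> F" "(a, d) \<notin> F" "(d, a) \<notin> F"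
  shows "cov_model {a, b, c, d} E \<noteq> cov_model {a, b, c, d} F"
proof
  \<comment> \<open>The weight of \<open>b -> c\<close> is 0, so \<open>c\<close> is uncorrelated
    with \<open>a\<close> and \<open>b\<close>. These zeros force
    \<open>t (2, 1) = t (2, 3) = 0\<close>, and the row of \<open>d\<close> then cannot meet its
    equations with \<open>a\<close>, \<open>c\<close> and \<open>d\<close>.\<close>
  let ?s = "[[1, 1, 0, 1], [1, 3, 0, 4], [0, 0, 1, 1], [1, 4, 1, 11]]"
  assume eq: "cov_model {a, b, c, d} E = cov_model {a, b, c, d} F"
  have "\<exists>t. (\<forall>i<4. \<forall>j<4. ([a, b, c, d] ! i, [a, b, c, d] ! j) \<notin> F \<longrightarrow> t (j, i) = 0) \<and>
      lyapunov_equation {..<4} t (\<lambda>(i, j). ?s ! i ! j)"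
    by (rule cov_model_eq_certificate[where E = E and m = "[[-1, 0, 0, 0], [2, -1, 0, 0], [0, 0, -1, 0], [0, 2, 2, -1]]"
        and l = "[[1, 0, 0, 0], [1, 1, 0, 0], [0, 0, 1, 0], [1, 3/2, 1, 1]]" and d = "[1, 2, 1, 9/2]"])
      (use assms(1-3) eq in \<open>simp_all add: certificate_simps\<close>)
  then obtain t where "\<forall>i<4. \<forall>j<4. ([a, b, c, d] ! i, [a, b, c, d] ! j) \<notin> F \<longrightarrow> t (j, i) = 0"
      "lyapunov_equation {..<4} t (\<lambda>(i, j). ?s ! i ! j)" by blast
  with assms(4-) show False by (simp add: certificate_simps; elim conjE; linarith)
qed

lemma cov_model_neq_grandchild:
  assumes "distinct [a, b, c, d]" "{(a, a), (b, b), (c, c), (d, d)} \<subseteq> E"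
    and "{(a, b), (a, c), (b, c), (c, d)} \<subseteq> E"
    and "(a, b) \<notin> F" "(c, a) \<notin> F" "(c, b) \<notin> F" "(d, c) \<notin> F" "(a, d) \<notin> F" "(d, a) \<notin> F" "(b, d) \<notin> F" "(d, b) \<notin> F"
  shows "cov_model {a, b, c, d} E \<noteq> cov_model {a, b, c, d} F"
proof
  \<comment> \<open>The covariance of a chain \<open>a -> b -> c -> d\<close>, with weight 0 on
    \<open>a -> c\<close>. For \<open>F\<close> the rows of \<open>a\<close> and \<open>b\<close>
    are determined, and the two entries \<open>t (3, 2)\<close>, \<open>t (3, 3)\<close> cannot
    satisfy the three equations of \<open>d\<close> with \<open>a\<close>, \<open>b\<close> and
    itself.\<close>
  let ?s = "[[1, 1, 1, 1], [1, 3, 4, 5], [1, 4, 9, 14], [1, 5, 14, 29]]"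
  assume eq: "cov_model {a, b, c, d} E = cov_model {a, b, c, d} F"
  have "\<exists>t. (\<forall>i<4. \<forall>j<4. ([a, b, c, d] ! i, [a, b, c, d] ! j) \<notin> F \<longrightarrow> t (j, i) = 0) \<and>
      lyapunov_equation {..<4} t (\<lambda>(i, j). ?s ! i ! j)"
    by (rule cov_model_eq_certificate[where E = E and m = "[[-1, 0, 0, 0], [2, -1, 0, 0], [0, 2, -1, 0], [0, 0, 2, -1]]"
        and l = "[[1, 0, 0, 0], [1, 1, 0, 0], [1, 3/2, 1, 0], [1, 2, 2, 1]]" and d = "[1, 2, 7/2, 6]"])
      (use assms(1-3) eq in \<open>simp_all add: certificate_simps\<close>)
  then obtain t where "\<forall>i<4. \<forall>j<4. ([a, b, c, d] ! i, [a, b, c, d] ! j) \<notin> F \<longrightarrow> t (j, i) = 0"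
      "lyapunov_equation {..<4} t (\<lambda>(i, j). ?s ! i ! j)" by blast
  with assms(4-) show False by (simp add: certificate_simps; elim conjE; linarith)
qed

section \<open>Reversing edges\<close>

definition adjacent :: "('v \<times> 'v) set \<Rightarrow> 'v \<Rightarrow> 'v \<Rightarrow> bool" where
  "adjacent E u v \<longleftrightarrow> u \<noteq> v \<and> ((u, v) \<in> E \<or> (v, u) \<in> E)"

lemma adjacent_commute: "adjacent E u v \<longleftrightarrow> adjacent E v u"
  by (auto simp: adjacent_def)

text \<open>The number of strict ancestors grows along every edge.\<close>

lemma finite_acyclic_rank:
  assumes "finite r" "acyclic r"
  obtains rank :: "'v \<Rightarrow> nat" where "\<And>u v. (u, v) \<in> r \<Longrightarrow> rank u < rank v"
proof
  fix u v assume uv: "(u, v) \<in> r"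
  have "finite (r\<^sup>+)" using assms(1) by simp
  then have "finite {w. (w, v) \<in> r\<^sup>+}" by (rule finite_surj[where f = fst]) force
  moreover have "{w. (w, u) \<in> r\<^sup>+} \<subset> {w. (w, v) \<in> r\<^sup>+}"
    using uv assms(2) unfolding acyclic_def by (auto intro: trancl_into_trancl)
  ultimately show "card {w. (w, u) \<in> r\<^sup>+} < card {w. (w, v) \<in> r\<^sup>+}" by (rule psubset_card_mono)
qed

text \<open>Orientations are required in \<open>E \<inter> F\<close>: edges on which the graphs
  agree are never reversed, so the property outlives the reversal of other edges.\<close>

definition flippable :: "'v set \<Rightarrow> ('v \<times> 'v) set \<Rightarrow> ('v \<times> 'v) set \<Rightarrow> 'v \<Rightarrow> 'v \<Rightarrow> bool" where
  "flippable V E F i j \<longleftrightarrow>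
    (\<forall>u \<in> V - {i, j}. adjacent E u i \<longleftrightarrow> adjacent E u j) \<and>
    (\<forall>u \<in> V - {i, j}. \<forall>v \<in> V - {i, j}. u \<noteq> v \<and> adjacent E u i \<and> adjacent E v i \<and> \<not> adjacent E u v \<longrightarrow>
      {(u, i), (u, j), (v, i), (v, j)} \<subseteq> E \<inter> F \<or> {(i, u), (j, u), (i, v), (j, v)} \<subseteq> E \<inter> F) \<and>
    (\<forall>u \<in> V - {i, j}. \<forall>v \<in> V - {i, j}. adjacent E u i \<and> adjacent E u v \<and> \<not> adjacent E v i \<longrightarrow>
      {(v, u), (i, u), (j, u)} \<subseteq> E \<inter> F)"

lemma flippable_twin:
  "flippable V E F i j \<Longrightarrow> u \<in> V - {i, j} \<Longrightarrow> adjacent E u i \<longleftrightarrow> adjacent E u j"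
  by (simp add: flippable_def)

lemma flippable_fork:
  assumes "flippable V E F i j" "u \<in> V - {i, j}" "v \<in> V - {i, j}"
    and "u \<noteq> v" "adjacent E u i" "adjacent E v i" "\<not> adjacent E u v"
  shows "{(u, i), (u, j), (v, i), (v, j)} \<subseteq> E \<inter> F \<or> {(i, u), (j, u), (i, v), (j, v)} \<subseteq> E \<inter> F"
  using assms unfolding flippable_def by (elim conjE) (drule (1) bspec, drule (1) bspec, simp)

lemma flippable_outer:
  assumes "flippable V E F i j" "u \<in> V - {i, j}" "v \<in> V - {i, j}"
    and "adjacent E u i" "adjacent E u v" "\<not> adjacent E v i"
  shows "{(v, u), (i, u), (j, u)} \<subseteq> E \<inter> F"
proof -
  have "\<forall>u \<in> V - {i, j}. \<forall>v \<in> V - {i, j}. adjacent E u i \<and> adjacent E u v \<and> \<not> adjacent E v i \<longrightarrow>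
      {(v, u), (i, u), (j, u)} \<subseteq> E \<inter> F"
    using assms(1) unfolding flippable_def by (elim conjE)
  from this[rule_format, OF assms(2,3)] show ?thesis using assms(4-6) by simp
qed

lemma flippable_mono:
  assumes "flippable V E F i j" "adjacent E = adjacent E'" "E \<inter> F \<subseteq> E' \<inter> F"
  shows "flippable V E' F i j"
proof -
  have "A \<subseteq> E' \<inter> F" if "A \<subseteq> E \<inter> F" for A
    using that assms(3) by (rule subset_trans)
  then show ?thesis
    using flippable_twin[OF assms(1)] flippable_fork[OF assms(1)] flippable_outer[OF assms(1)]
    unfolding assms(2) by (subst flippable_def) (intro conjI ballI impI; metis)
qed

text \<open>This keeps the graph acyclic after the reversal. The first step \<open>i -> k\<close> of
  such a path has \<open>rank k \<le> rank j\<close>, and \<open>k\<close> is adjacent to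
  \<open>j\<close> by the twin condition, so \<open>i -> k -> j\<close> would be a triangle.\<close>

lemma flip_no_path:
  fixes rank :: "'v \<Rightarrow> nat"
  assumes "E \<subseteq> V \<times> V" and rank: "\<And>u v. (u, v) \<in> E \<Longrightarrow> u \<noteq> v \<Longrightarrow> rank u < rank v"
    and "flippable V E F i j" "i \<noteq> j" and no_triangle: "\<And>k. (i, k) \<in> E \<Longrightarrow> (k, j) \<in> E \<Longrightarrow> k \<in> {i, j}"
  shows "(i, j) \<notin> (E - Id - {(i, j)})\<^sup>*"
proof
  assume "(i, j) \<in> (E - Id - {(i, j)})\<^sup>*"
  then obtain k where k: "(i, k) \<in> E - Id - {(i, j)}" "(k, j) \<in> (E - Id - {(i, j)})\<^sup>*"
    using assms(4) by (metis converse_rtranclE)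
  from k(2) have "rank k \<le> rank j"
    by induction (use rank in \<open>force dest: less_imp_le\<close>)+
  then have nkj: "(j, k) \<notin> E" using rank[of j k] k by auto
  have "k \<in> V - {i, j}" using k assms(1) by auto
  moreover have "adjacent E k i" using k by (auto simp: adjacent_def)
  ultimately have "adjacent E k j" using flippable_twin[OF assms(3)] by blast
  then have "(k, j) \<in> E" using nkj by (auto simp: adjacent_def)
  then show False using no_triangle[of k] k by auto
qed

lemma cov_model_flippable_subset:
  fixes rank :: "'v \<Rightarrow> nat"
  assumes fin: "finite V" and E: "E \<subseteq> V \<times> V" "\<And>v. v \<in> V \<Longrightarrow> (v, v) \<in> E"
    and rank: "\<And>u v. (u, v) \<in> E \<Longrightarrow> u \<noteq> v \<Longrightarrow> rank u < rank v"
    and ij: "(i, j) \<in> E" "i \<noteq> j" and flip: "flippable V E F i j"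
    and no_triangle: "\<And>k. (i, k) \<in> E \<Longrightarrow> (k, j) \<in> E \<Longrightarrow> k \<in> {i, j}"
  shows "cov_model V E \<subseteq> cov_model V (insert (j, i) (E - {(i, j)}))"
proof -
  \<comment> \<open>\<open>i\<close> belongs to \<open>B\<close> by its self-loop. The parents of
    \<open>j\<close> turn out to lie in \<open>B\<close> as well, for lack of a triangle over
    \<open>i -> j\<close>.\<close>
  define B where "B = {u \<in> V. (u, i) \<in> E} \<union> {j}"
  define Q where "Q = {q \<in> V. q \<noteq> i \<and> q \<noteq> j \<and> \<not> adjacent E q i}"
  have V: "i \<in> V" "j \<in> V" using ij E by auto
  have asym: "(v, u) \<notin> E" if "(u, v) \<in> E" "u \<noteq> v" for u v using rank[of u v] rank[of v u] that by fastforce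
  have twin: "adjacent E u i \<longleftrightarrow> adjacent E u j" if "u \<in> V" "u \<noteq> i" "u \<noteq> j" for u
    using flippable_twin[OF flip] that by simp
  have fork: "{(u, i), (u, j), (v, i), (v, j)} \<subseteq> E \<or> {(i, u), (j, u), (i, v), (j, v)} \<subseteq> E"
    if "u \<in> V - {i, j}" "v \<in> V - {i, j}" "u \<noteq> v" "adjacent E u i" "adjacent E v i" "\<not> adjacent E u v" for u v
    using flippable_fork[OF flip] that by (metis inf.boundedE)
  have outer: "{(v, u), (i, u), (j, u)} \<subseteq> E"
    if "u \<in> V - {i, j}" "v \<in> V - {i, j}" "adjacent E u i" "adjacent E u v" "\<not> adjacent E v i" for u v
    using flippable_outer[OF flip] that by (metis inf.boundedE)
  have parent: "(u, j) \<in> E" if "(u, i) \<in> E" for u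
  proof (cases "u = i")
    case False
    have "u \<noteq> j" using asym ij that by blast
    moreover have "(j, u) \<notin> E"
      using rank[OF that False] rank[OF ij] rank[of j u] \<open>u \<noteq> j\<close> by fastforce
    moreover have "u \<in> V" using that E by auto
    moreover have "adjacent E u i" using that False by (simp add: adjacent_def)
    ultimately show ?thesis using twin[of u] False by (auto simp: adjacent_def)
  qed (use ij in simp)
  have child: "(j, u) \<in> E" if "(i, u) \<in> E" "u \<noteq> i" for u
  proof (cases "u = j")
    case False
    moreover have "u \<in> V" using that E by auto
    moreover have "adjacent E u i" using that by (simp add: adjacent_def)
    ultimately show ?thesis using twin[of u] that no_triangle[of u] by (auto simp: adjacent_def)
  qed (use V E in simp)
  have BV: "B \<subseteq> V" using V by (auto simp: B_def)
  show ?thesis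
  proof (rule cov_model_flip_subset[OF fin, of E rank B Q i j])
    \<comment> \<open>A parent of \<open>j\<close> outside \<open>B\<close> would be a child of
      \<open>i\<close>, giving a triangle. A parent of a parent \<open>b\<close> of \<open>i\<close>
      that is not adjacent to \<open>i\<close> would force \<open>i -> b\<close>.\<close>
    show "u \<in> B" if u: "u \<in> V" "b \<in> B" "(u, b) \<in> E" for u b
    proof (rule ccontr)
      assume "u \<notin> B"
      then have ui: "(u, i) \<notin> E" "u \<noteq> j" "u \<noteq> i" using u V E by (auto simp: B_def)
      have bi: "b \<noteq> i" using u ui by auto
      show False
      proof (cases "b = j")
        case True
        then have "adjacent E u i" using u ui twin[of u] by (auto simp: adjacent_def)
        then have "(i, u) \<in> E" using ui by (auto simp: adjacent_def)
        then show False using no_triangle[of u] u True ui by auto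
      next
        case False
        then have b: "(b, i) \<in> E" "b \<in> V" using u by (auto simp: B_def)
        have "u \<noteq> b" using b ui by auto
        then have "rank u < rank i" using rank[OF u(3)] rank[OF b(1) bi] by simp
        then have "(i, u) \<notin> E" using rank[of i u] ui by auto
        then have "\<not> adjacent E u i" using ui by (simp add: adjacent_def)
        then have "(i, b) \<in> E"
          using outer[of b u] u b bi False ui \<open>u \<noteq> b\<close> by (auto simp: adjacent_def)
        then show False using asym b bi by blast
      qed
    qed
    \<comment> \<open>\<open>outer\<close> orients every edge between \<open>Q\<close> and a
      neighbour of \<open>i\<close> away from \<open>Q\<close>.\<close>
    show "u \<in> Q" if u: "u \<in> V" "q \<in> Q" "(u, q) \<in> E" for u q
    proof (rule ccontr)
      assume "u \<notin> Q"
      moreover have q: "q \<in> V" "q \<noteq> i" "q \<noteq> j" "\<not> adjacent E q i" using u by (auto simp: Q_def)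
      moreover have "u \<noteq> i" using q u by (auto simp: adjacent_def)
      moreover have "u \<noteq> j" using q u twin[of q] by (auto simp: adjacent_def)
      ultimately have au: "adjacent E u i" "u \<noteq> i" "u \<noteq> j" "u \<noteq> q" using u by (auto simp: Q_def)
      then have "(q, u) \<in> E" using outer[of u q] u q by (auto simp: adjacent_def)
      then show False using asym[of q u] u au by auto
    qed
    \<comment> \<open>\<open>r\<close> is a child of \<open>i\<close>, and \<open>u\<close> is
      \<open>i\<close>, \<open>j\<close> or a parent of \<open>i\<close>. A parent and a child of
      \<open>i\<close> that are not adjacent would contradict \<open>fork\<close>.\<close>
    show "(u, r) \<in> E" if u: "u \<in> B" "r \<in> V - B - Q" for u r
    proof -
      have r: "r \<in> V" "r \<noteq> i" "r \<noteq> j" "(i, r) \<in> E"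
        using u V E by (auto simp: B_def Q_def adjacent_def)
      show ?thesis
      proof (cases "u = i \<or> u = j")
        case True
        then show ?thesis using r child by auto
      next
        case False
        then have "(u, i) \<in> E" "u \<in> V" using u by (auto simp: B_def)
        moreover have "rank u < rank r" using rank[of u i] rank[of i r] calculation r False by fastforce
        then have "u \<noteq> r" "(r, u) \<notin> E" using rank[of r u] by fastforce+
        moreover have "(r, i) \<notin> E" using asym r by blast
        ultimately show ?thesis
          using fork[of u r] r False asym[of u i] by (auto simp: adjacent_def)
      qed
    qed
    show "(u, i) \<in> E" if "u \<in> B" "u \<noteq> j" for u using that by (auto simp: B_def)
    show "(u, j) \<in> E" if "u \<in> B" for u using that parent V E by (auto simp: B_def)
    show "Q \<subseteq> V - B" by (auto simp: Q_def B_def adjacent_def)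
  qed (use rank BV V E ij in \<open>auto simp: B_def\<close>)
qed

section \<open>Two DAGs with the same skeleton\<close>

locale dag_pair =
  fixes V :: "'v set" and E F :: "('v \<times> 'v) set"
  assumes finite_V: "finite V"
    and E_subset: "E \<subseteq> V \<times> V" and F_subset: "F \<subseteq> V \<times> V"
    and loops_E: "v \<in> V \<Longrightarrow> (v, v) \<in> E" and loops_F: "v \<in> V \<Longrightarrow> (v, v) \<in> F"
    and acyclic_E: "acyclic (E - Id)" and acyclic_F: "acyclic (F - Id)"
    and adjacent_eq: "adjacent E = adjacent F"
begin

lemma swap: "dag_pair V F E"
  using finite_V E_subset F_subset loops_E loops_F acyclic_E acyclic_F adjacent_eq
  by (simp add: dag_pair_def)

lemma trancl_E_irrefl: "(a, a) \<notin> (E - Id)\<^sup>+"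
  using acyclic_E by (simp add: acyclic_def)

lemma no_triangle_E:
  assumes "(a, b) \<in> E" "(b, c) \<in> E" "(c, a) \<in> E" "a \<noteq> b" "b \<noteq> c" "c \<noteq> a"
  shows False
proof -
  have "(a, b) \<in> (E - Id)\<^sup>+" "(b, c) \<in> E - Id" "(c, a) \<in> E - Id" using assms by auto
  then have "(a, a) \<in> (E - Id)\<^sup>+" by (meson trancl_into_trancl)
  then show False using trancl_E_irrefl by simp
qed

lemma asym_E:
  assumes "(a, b) \<in> E" "a \<noteq> b"
  shows "(b, a) \<notin> E"
proof
  assume "(b, a) \<in> E"
  then have "(a, b) \<in> (E - Id)\<^sup>+" "(b, a) \<in> E - Id" using assms by auto
  then have "(a, a) \<in> (E - Id)\<^sup>+" by (rule trancl_into_trancl)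
  then show False using trancl_E_irrefl by simp
qed

end

text \<open>Induction on the number of edges in \<open>E - F\<close>. Reversing one with the least
  rank difference yields a DAG with the same skeleton and leaves the other disagreeing edges
  flippable.\<close>

lemma cov_model_subset_if_flippable:
  assumes "dag_pair V E F"
    and "\<And>i j. (i, j) \<in> E \<Longrightarrow> (j, i) \<in> F \<Longrightarrow> i \<noteq> j \<Longrightarrow> flippable V E F i j"
  shows "cov_model V E \<subseteq> cov_model V F"
  using assms
proof (induction "card (E - F)" arbitrary: E rule: less_induct)
  case less
  interpret dag_pair V E F by (rule less.prems)
  interpret sw: dag_pair V F E by (rule swap)
  have finE: "finite E" using finite_V E_subset by (meson finite_SigmaI finite_subset)
  show ?case
  proof (cases "E - F = {}")
    case True
    then show ?thesis unfolding cov_model_def by blast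
  next
    case False
    obtain rank :: "'a \<Rightarrow> nat" where rank': "\<And>u v. (u, v) \<in> E - Id \<Longrightarrow> rank u < rank v"
      using finite_acyclic_rank[OF finite_Diff[OF finE] acyclic_E] by blast
    have rank: "rank u < rank v" if "(u, v) \<in> E" "u \<noteq> v" for u v using rank' that by blast
    \<comment> \<open>Natural subtraction is exact on the edges compared, as ranks increase along
      them.\<close>
    define len where "len = (\<lambda>(u, v). rank v - rank u)"
    obtain i j where ij: "(i, j) \<in> E - F" and least: "\<And>u v. (u, v) \<in> E - F \<Longrightarrow> len (i, j) \<le> len (u, v)"
    proof -
      obtain e where "e \<in> E - F" using False by auto
      from ex_has_least_nat[of "\<lambda>e. e \<in> E - F", OF this, of len]
      obtain e where "e \<in> E - F" "\<And>e'. e' \<in> E - F \<Longrightarrow> len e \<le> len e'" by blast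
      then show ?thesis using that by (cases e) blast
    qed
    have ne: "i \<noteq> j" using ij loops_F E_subset by auto
    have flipped: "(v, u) \<in> F" if "(u, v) \<in> E - F" "u \<noteq> v" for u v
      using fun_cong[OF fun_cong[OF adjacent_eq, of u], of v] that by (auto simp: adjacent_def)
    have flip: "flippable V E F i j" using less.prems(2) ij flipped[OF ij ne] ne by blast
    \<comment> \<open>A directed triangle over \<open>i \<rightarrow> j\<close> would contain a shorter flipped edge, as \<open>F\<close> is acyclic.\<close>
    have no_triangle: "k \<in> {i, j}" if k: "(i, k) \<in> E" "(k, j) \<in> E" for k
    proof (rule ccontr)
      assume "k \<notin> {i, j}"
      then have kn: "k \<noteq> i" "k \<noteq> j" by auto
      then have r: "rank i < rank k" "rank k < rank j" using rank k by auto
      then have "(i, k) \<in> F" "(k, j) \<in> F"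
        using least[of i k] least[of k j] k by (fastforce simp: len_def)+
      then show False using sw.no_triangle_E flipped[OF ij ne] kn ne by blast
    qed
    define E' where "E' = insert (j, i) (E - {(i, j)})"
    have sub: "cov_model V E \<subseteq> cov_model V E'"
      unfolding E'_def
      by (rule cov_model_flippable_subset[OF finite_V E_subset loops_E rank _ ne flip no_triangle]) (use ij in auto)
    have adj: "adjacent E = adjacent E'"
      using ij by (intro ext) (auto simp: adjacent_def E'_def)
    have "E' - Id = insert (j, i) (E - Id - {(i, j)})" using ne by (auto simp: E'_def)
    moreover have "acyclic (E - Id - {(i, j)})" using acyclic_E by (rule acyclic_subset) auto
    moreover have "(i, j) \<notin> (E - Id - {(i, j)})\<^sup>*"
      by (rule flip_no_path[OF E_subset rank flip ne no_triangle])
    ultimately have acyc: "acyclic (E' - Id)" by (simp add: acyclic_insert)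
    have pair: "dag_pair V E' F"
      using finite_V E_subset F_subset loops_E loops_F acyc acyclic_F adj adjacent_eq ij ne
      by unfold_locales (auto simp: E'_def)
    have "E' - F = E - F - {(i, j)}" using flipped[OF ij ne] by (auto simp: E'_def)
    then have "card (E' - F) < card (E - F)" using ij finE by (metis card_Diff1_less finite_Diff)
    moreover have "flippable V E' F a b" if "(a, b) \<in> E'" "(b, a) \<in> F" "a \<noteq> b" for a b
    proof (rule flippable_mono[OF _ adj])
      show "flippable V E F a b" using that ij less.prems(2) by (auto simp: E'_def)
      show "E \<inter> F \<subseteq> E' \<inter> F" using ij by (auto simp: E'_def)
    qed
    ultimately have "cov_model V E' \<subseteq> cov_model V F" using less.hyps pair by blast
    with sub show ?thesis by (rule subset_trans)
  qed
qed

section \<open>Consequences of equivalence on at most four vertices\<close>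

locale locally_equivalent_dags = dag_pair +
  assumes local_eq: "K \<subseteq> V \<Longrightarrow> card K \<le> 4 \<Longrightarrow> cov_model K E = cov_model K F"
begin

lemma swap_local: "locally_equivalent_dags V F E"
  using swap local_eq by (simp add: locally_equivalent_dags_def locally_equivalent_dags_axioms_def)

lemma edge_cases: "(u, v) \<in> E \<or> (v, u) \<in> E \<longleftrightarrow> (u, v) \<in> F \<or> (v, u) \<in> F"
  if "u \<noteq> v"
  using fun_cong[OF fun_cong[OF adjacent_eq, of u], of v] that by (simp add: adjacent_def)

text \<open>A vertex adjacent to \<open>i\<close> but not to \<open>j\<close> would form a chain
  \<open>u -> i -> j\<close> or a fork at \<open>i\<close>, and the three-vertex separations forbid
  the reversal of \<open>i -> j\<close> in both.\<close>

lemma flipped_twin_subset: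
  assumes ij: "(i, j) \<in> E" "(j, i) \<in> F" "i \<noteq> j" and u: "u \<in> V" "u \<noteq> i" "u \<noteq> j"
    and adj: "adjacent E u i"
  shows "adjacent E u j"
proof (rule ccontr)
  interpret sw: dag_pair V F E by (rule swap)
  assume "\<not> adjacent E u j"
  then have uj: "(u, j) \<notin> F" "(j, u) \<notin> F" using u adjacent_eq by (auto simp: adjacent_def)
  have V: "i \<in> V" "j \<in> V" using ij E_subset by auto
  have ijF: "(i, j) \<notin> F" using sw.asym_E ij by blast
  have uiF: "(u, i) \<notin> F \<or> (i, u) \<notin> F" using sw.asym_E u by blast
  from adj consider "(u, i) \<in> E" | "(i, u) \<in> E" by (auto simp: adjacent_def)
  then show False
  proof cases
    case 1
    have "cov_model {u, i, j} E \<noteq> cov_model {u, i, j} F"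
      by (rule cov_model_neq_chain) (use 1 ij u V uj ijF uiF loops_E in auto)
    then show False using local_eq[of "{u, i, j}"] u V by (simp add: card_insert_if)
  next
    case 2
    have "cov_model {i, j, u} E \<noteq> cov_model {i, j, u} F"
      by (rule cov_model_neq_fork) (use 2 ij u V uj ijF uiF loops_E in auto)
    then show False using local_eq[of "{i, j, u}"] u V by (simp add: card_insert_if)
  qed
qed

lemma flipped_twin:
  assumes "(i, j) \<in> E" "(j, i) \<in> F" "i \<noteq> j" "u \<in> V" "u \<noteq> i" "u \<noteq> j"
  shows "adjacent E u i \<longleftrightarrow> adjacent E u j"
  using flipped_twin_subset[of i j u] assms
    locally_equivalent_dags.flipped_twin_subset[OF swap_local, of j i u] adjacent_eq by auto

text \<open>Contrapositive of \<open>flipped_twin\<close>, applied to both directions of the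
  edge.\<close>

lemma edge_agree:
  assumes "u \<in> V" "v \<in> V" "w \<in> V" "w \<noteq> u" "w \<noteq> v" "u \<noteq> v" "adjacent E w u \<noteq> adjacent E w v"
  shows "(u, v) \<in> E \<longleftrightarrow> (u, v) \<in> F"
proof -
  interpret sw: dag_pair V F E by (rule swap)
  have "\<not> ((u, v) \<in> E \<and> (v, u) \<in> F)" "\<not> ((v, u) \<in> E \<and> (u, v) \<in> F)"
    using flipped_twin[of u v w] flipped_twin[of v u w] assms by auto
  then show ?thesis using edge_cases[OF assms(6)] asym_E sw.asym_E assms(6) by blast
qed

text \<open>By \<open>edge_agree\<close> the vertex \<open>w\<close> fixes the edges between
  \<open>u\<close> and \<open>i\<close>, \<open>j\<close> in both graphs. Mixed directions would
  close a directed triangle with \<open>i -> j\<close> in \<open>E\<close> or with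
  \<open>j -> i\<close> in \<open>F\<close>.\<close>

lemma common_neighbour:
  assumes ij: "(i, j) \<in> E" "(j, i) \<in> F" "i \<noteq> j" and u: "u \<in> V - {i, j}" "adjacent E u i"
    and w: "w \<in> V - {i, j, u}" "adjacent E w i \<noteq> adjacent E w u"
  shows "{(u, i), (u, j)} \<subseteq> E \<inter> F \<or> {(i, u), (j, u)} \<subseteq> E \<inter> F"
proof -
  interpret sw: dag_pair V F E by (rule swap)
  have V: "i \<in> V" "j \<in> V" using ij E_subset by auto
  have "adjacent E w i \<longleftrightarrow> adjacent E w j" using flipped_twin[OF ij] w by simp
  then have agree: "(u, i) \<in> E \<longleftrightarrow> (u, i) \<in> F" "(i, u) \<in> E \<longleftrightarrow> (i, u) \<in> F"
    "(u, j) \<in> E \<longleftrightarrow> (u, j) \<in> F" "(j, u) \<in> E \<longleftrightarrow> (j, u) \<in> F"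
    using edge_agree[of u i w] edge_agree[of i u w] edge_agree[of u j w] edge_agree[of j u w] u w V by auto
  have "adjacent E u j" using flipped_twin[OF ij] u by simp
  moreover have "\<not> ((u, i) \<in> E \<and> (j, u) \<in> E)" using no_triangle_E[of u i j] ij u by auto
  moreover have "\<not> ((i, u) \<in> F \<and> (u, j) \<in> F)" using sw.no_triangle_E[of i u j] ij u by auto
  ultimately show ?thesis using agree u by (auto simp: adjacent_def)
qed

lemma flipped_imp_flippable:
  assumes ij: "(i, j) \<in> E" "(j, i) \<in> F" "i \<noteq> j"
  shows "flippable V E F i j"
proof -
  interpret sw: dag_pair V F E by (rule swap)
  have V: "i \<in> V" "j \<in> V" using ij E_subset by auto
  have ijF: "(i, j) \<notin> F" using sw.asym_E ij by blast
  \<comment> \<open>Excludes the mixed case of \<open>fork\<close>, a parent \<open>u\<close> and a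
    child \<open>v\<close> of both endpoints.\<close>
  have through: "adjacent E u v"
    if "u \<in> V - {i, j}" "v \<in> V - {i, j}" "u \<noteq> v" "{(u, i), (u, j)} \<subseteq> E \<inter> F" "{(i, v), (j, v)} \<subseteq> E \<inter> F" for u v
  proof (rule ccontr)
    assume "\<not> adjacent E u v"
    then have uv: "(u, v) \<notin> F" "(v, u) \<notin> F" using that adjacent_eq by (auto simp: adjacent_def)
    have "(i, u) \<notin> F" "(j, u) \<notin> F" "(v, i) \<notin> F" "(v, j) \<notin> F"
      using sw.asym_E that by blast+
    then have "cov_model {u, i, j, v} E \<noteq> cov_model {u, i, j, v} F"
      by (intro cov_model_neq_through) (use that V ij ijF uv loops_E in auto)
    then show False using local_eq[of "{u, i, j, v}"] card_length[of "[u, i, j, v]"] that V by simp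
  qed
  have fork: "{(u, i), (u, j), (v, i), (v, j)} \<subseteq> E \<inter> F \<or> {(i, u), (j, u), (i, v), (j, v)} \<subseteq> E \<inter> F"
    if uv: "u \<in> V - {i, j}" "v \<in> V - {i, j}" "u \<noteq> v" "adjacent E u i" "adjacent E v i" "\<not> adjacent E u v" for u v
  proof -
    have vu: "\<not> adjacent E v u" using uv(6) adjacent_commute by metis
    show ?thesis
      using common_neighbour[OF ij uv(1,4), of v] common_neighbour[OF ij uv(2,5), of u]
        through[OF uv(1-3)] through[OF uv(2,1)] uv vu by auto
  qed
  have outer: "{(v, u), (i, u), (j, u)} \<subseteq> E \<inter> F"
    if uv: "u \<in> V - {i, j}" "v \<in> V - {i, j}" "adjacent E u i" "adjacent E u v" "\<not> adjacent E v i" for u v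
  proof -
    have ne: "u \<noteq> v" using uv by (auto simp: adjacent_def)
    have "\<not> adjacent E v j" using flipped_twin[OF ij] uv by simp
    then have vij: "(v, i) \<notin> F" "(i, v) \<notin> F" "(v, j) \<notin> F" "(j, v) \<notin> F"
      using uv adjacent_eq by (auto simp: adjacent_def)
    have "adjacent E v u" using uv(4) adjacent_commute by metis
    \<comment> \<open>\<open>v\<close> is adjacent to \<open>u\<close> but not to \<open>i\<close>,
      so it serves as the \<open>w\<close> of \<open>common_neighbour\<close>.\<close>
    then have ends: "{(u, i), (u, j)} \<subseteq> E \<inter> F \<or> {(i, u), (j, u)} \<subseteq> E \<inter> F"
      using common_neighbour[OF ij uv(1,3), of v] uv ne by auto
    have "adjacent E i u" "\<not> adjacent E i v" using uv adjacent_commute by metis+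
    then have agree: "(u, v) \<in> E \<longleftrightarrow> (u, v) \<in> F" "(v, u) \<in> E \<longleftrightarrow> (v, u) \<in> F"
      using edge_agree[of u v i] edge_agree[of v u i] uv ne V by auto
    have same: "cov_model {u, i, j, v} E = cov_model {u, i, j, v} F"
      using local_eq[of "{u, i, j, v}"] card_length[of "[u, i, j, v]"] uv V by simp
    \<comment> \<open>Of the four orientations of \<open>u\<close> towards \<open>{i, j}\<close> and
      towards \<open>v\<close>, three contradict \<open>same\<close>; only the one with
      \<open>i\<close>, \<open>j\<close> and \<open>v\<close> as parents of \<open>u\<close>
      remains.\<close>
    from ends show ?thesis
    proof
      assume ui: "{(u, i), (u, j)} \<subseteq> E \<inter> F"
      then have iu: "(i, u) \<notin> F" "(j, u) \<notin> F" using sw.asym_E uv by blast+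
      from uv(4) consider "(u, v) \<in> E" | "(v, u) \<in> E" by (auto simp: adjacent_def)
      then have False
      proof cases
        case 1
        then have "(v, u) \<notin> F" using agree sw.asym_E ne by blast
        then have "cov_model {u, i, j, v} E \<noteq> cov_model {u, i, j, v} F"
          by (intro cov_model_neq_parent_child) (use 1 ui iu uv ne V ij ijF vij loops_E in auto)
        with same show False by simp
      next
        case 2
        then have "(u, v) \<notin> F" using agree sw.asym_E ne by blast
        then have "cov_model {v, u, i, j} E \<noteq> cov_model {v, u, i, j} F"
          by (intro cov_model_neq_grandparent) (use 2 ui iu uv ne V ij ijF vij loops_E in auto)
        moreover have "{v, u, i, j} = {u, i, j, v}" by auto
        ultimately show False using same by simp
      qed
      then show ?thesis ..
    next
      assume iu: "{(i, u), (j, u)} \<subseteq> E \<inter> F"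
      then have ui: "(u, i) \<notin> F" "(u, j) \<notin> F" using sw.asym_E uv by blast+
      have "(u, v) \<notin> E"
      proof
        assume 1: "(u, v) \<in> E"
        then have "(v, u) \<notin> F" using agree sw.asym_E ne by blast
        then have "cov_model {i, j, u, v} E \<noteq> cov_model {i, j, u, v} F"
          by (intro cov_model_neq_grandchild) (use 1 ui iu uv ne V ij ijF vij loops_E in auto)
        moreover have "{i, j, u, v} = {u, i, j, v}" by auto
        ultimately show False using same by simp
      qed
      then show ?thesis using uv(4) agree iu by (auto simp: adjacent_def)
    qed
  qed
  show ?thesis
    unfolding flippable_def
  proof (intro conjI ballI impI; (elim conjE)?)
    show "adjacent E u i \<longleftrightarrow> adjacent E u j" if "u \<in> V - {i, j}" for u
      using flipped_twin[OF ij] that by simp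
  qed (rule fork outer; assumption)+
qed

lemma cov_model_subset: "cov_model V E \<subseteq> cov_model V F"
  using cov_model_subset_if_flippable[OF dag_pair_axioms] flipped_imp_flippable by blast

end

section \<open>From digraphs to edge sets, and the equivalence\<close>

text \<open>Self-loops are removed first, so that the cycle extracted from a closed walk cannot be a
  single loop.\<close>

lemma dag_acyclic:
  assumes "dag G"
  shows "acyclic (parcs G - Id)"
  unfolding acyclic_def
proof (intro allI notI)
  interpret pair_fin_digraph G using assms by (simp add: dag_def)
  define H where "H = \<lparr>pverts = pverts G, parcs = parcs G - Id\<rparr>"
  have wf: "pair_wf_digraph H"
    using in_arcsD1 in_arcsD2 by unfold_locales (auto simp: H_def dest: in_arcsD1 in_arcsD2)
  then interpret H: pair_wf_digraph H .
  fix x assume "(x, x) \<in> (parcs G - Id)\<^sup>+"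
  then obtain p where "H.awalk x p x" "p \<noteq> []"
    using H.reachable1_awalk[of x x] by (auto simp: H_def)
  then obtain c where c: "H.cycle c" using H.closed_w_imp_cycle by (auto simp: H.closed_w_def)
  have "subgraph (with_proj H) (with_proj G)"
    using wf_digraph_axioms H.wf_digraph_axioms by (auto simp: subgraph_def compatible_def H_def)
  then have "cycle c" using c subgraph_cycle by blast
  moreover have "length c > 1"
  proof (rule ccontr)
    assume "\<not> ?thesis"
    moreover have "c \<noteq> []" using c by (auto simp: H.cycle_def)
    ultimately obtain e where "c = [e]" by (cases c) auto
    then have "e \<in> parcs H" "fst e = snd e"
      using c by (auto simp: H.cycle_def H.awalk_Cons_iff H.awalk_Nil_iff)
    then show False by (cases e) (auto simp: H_def)
  qed
  ultimately show False using assms by (auto simp: dag_def)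
qed

text \<open>Three vertices are excluded: there the right-hand side reduces to equal skeletons, but
  \<open>a -> b -> c\<close> and \<open>a -> b <- c\<close> have different models by
  \<open>cov_model_neq_chain\<close>.\<close>

theorem theorem3p3:
  fixes G\<^sub>1 G\<^sub>2 :: "'v pair_pre_digraph" and V :: "'v set"
  assumes "dag G\<^sub>1" and "dag G\<^sub>2"
    and "pverts G\<^sub>1 = V" and "pverts G\<^sub>2 = V"
    and "card V \<noteq> 3"
  shows "model_equivalent (with_proj G\<^sub>1) (with_proj G\<^sub>2) \<longleftrightarrow>
    skeleton G\<^sub>1 = skeleton G\<^sub>2 \<and>
    (\<forall>K. K \<subseteq> V \<and> card K = 4 \<longrightarrow>
      model_equivalent (with_proj G\<^sub>1 \<restriction> K) (with_proj G\<^sub>2 \<restriction> K))"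
proof -
  define E F where "E = parcs G\<^sub>1" and "F = parcs G\<^sub>2"
  interpret G1: pair_fin_digraph G\<^sub>1 using assms(1) by (simp add: dag_def)
  interpret G2: pair_fin_digraph G\<^sub>2 using assms(2) by (simp add: dag_def)
  have fin: "finite V" using G1.pair_finite_verts assms(3) by simp
  have sub: "E \<subseteq> V \<times> V" "F \<subseteq> V \<times> V"
    using G1.in_arcsD1 G1.in_arcsD2 G2.in_arcsD1 G2.in_arcsD2 assms(3,4) by (auto simp: E_def F_def)
  have loops: "(v, v) \<in> E" "(v, v) \<in> F" if "v \<in> V" for v
    using assms(1-4) that by (auto simp: dag_def all_self_loops_def E_def F_def)
  have acyc: "acyclic (E - Id)" "acyclic (F - Id)"
    using dag_acyclic assms(1,2) by (auto simp: E_def F_def)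
  have model: "lyapunov_model (with_proj G) = cov_model V (parcs G)" if "pverts G = V" for G :: "'v pair_pre_digraph"
  proof -
    have "arcs_ends (with_proj G) = parcs G" by (auto simp: arcs_ends_def arc_to_ends_def)
    then show ?thesis using lyapunov_model_eq_cov_model[of "with_proj G"] that fin by simp
  qed
  have model_K: "lyapunov_model (with_proj G \<restriction> K) = cov_model K (parcs G)" if "K \<subseteq> V" for G :: "'v pair_pre_digraph" and K
  proof -
    have "finite K" using that fin by (rule finite_subset)
    then have "lyapunov_model (with_proj G \<restriction> K) = cov_model K (arcs_ends (with_proj G \<restriction> K))"
      using lyapunov_model_eq_cov_model[of "with_proj G \<restriction> K"] by simp
    also have "\<dots> = cov_model K (parcs G)"
      by (rule cov_model_cong) (force simp: arcs_ends_def arc_to_ends_def induce_subgraph_def)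
    finally show ?thesis .
  qed
  have whole: "model_equivalent (with_proj G\<^sub>1) (with_proj G\<^sub>2) \<longleftrightarrow> cov_model V E = cov_model V F"
    using assms(3,4) by (simp add: model_equivalent_def model E_def F_def)
  have part: "model_equivalent (with_proj G\<^sub>1 \<restriction> K) (with_proj G\<^sub>2 \<restriction> K) \<longleftrightarrow> cov_model K E = cov_model K F"
    if "K \<subseteq> V" for K
    using that by (simp add: model_equivalent_def model_K E_def F_def)
  have skel: "skeleton G\<^sub>1 = skeleton G\<^sub>2 \<longleftrightarrow> adjacent E = adjacent F"
  proof -
    have edge_set: "{u, v} \<in> {{i, j} | i j. i \<noteq> j \<and> ((i, j) \<in> A \<or> (j, i) \<in> A)} \<longleftrightarrow> adjacent A u v"
      for A :: "('v \<times> 'v) set" and u v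
      by (auto simp: adjacent_def doubleton_eq_iff)
    have set_eq: "{{i, j} | i j. i \<noteq> j \<and> ((i, j) \<in> A \<or> (j, i) \<in> A)} = {{i, j} | i j. adjacent A i j}"
      for A :: "('v \<times> 'v) set" by (simp add: adjacent_def)
    show ?thesis
    proof
      assume "skeleton G\<^sub>1 = skeleton G\<^sub>2"
      then have "adjacent E u v = adjacent F u v" for u v
        unfolding edge_set[symmetric] by (simp add: skeleton_def E_def F_def)
      then show "adjacent E = adjacent F" by (intro ext)
    next
      assume "adjacent E = adjacent F"
      then show "skeleton G\<^sub>1 = skeleton G\<^sub>2"
        using assms(3,4) by (simp add: skeleton_def set_eq E_def F_def)
    qed
  qed
  show ?thesis
    unfolding whole skel
  proof (intro iffI conjI allI impI)
    assume eq: "cov_model V E = cov_model V F"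
    have eq_K: "cov_model K E = cov_model K F" if "K \<subseteq> V" for K
      using cov_model_eq_subset[OF fin that loops eq] .
    \<comment> \<open>The models on two vertices show whether these are adjacent.\<close>
    have "(u, v) \<in> F \<or> (v, u) \<in> F" if "(u, v) \<in> E" "u \<noteq> v" for u v
    proof -
      have "u \<in> V" "v \<in> V" using that sub by auto
      then show ?thesis
        using cov_model_neq_edge[of u v E F] eq_K[of "{u, v}"] that loops by auto
    qed
    moreover have "(u, v) \<in> E \<or> (v, u) \<in> E" if "(u, v) \<in> F" "u \<noteq> v" for u v
    proof -
      have "u \<in> V" "v \<in> V" using that sub by auto
      then show ?thesis
        using cov_model_neq_edge[of u v F E] eq_K[of "{u, v}"] that loops by auto
    qed
    ultimately show "adjacent E = adjacent F"
      unfolding adjacent_def by (intro ext) blast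
    show "model_equivalent (with_proj G\<^sub>1 \<restriction> K) (with_proj G\<^sub>2 \<restriction> K)" if "K \<subseteq> V \<and> card K = 4" for K
      using part eq_K that by blast
  next
    assume "adjacent E = adjacent F \<and> (\<forall>K. K \<subseteq> V \<and> card K = 4 \<longrightarrow>
      model_equivalent (with_proj G\<^sub>1 \<restriction> K) (with_proj G\<^sub>2 \<restriction> K))"
    then have adj: "adjacent E = adjacent F"
      and four: "\<And>K. K \<subseteq> V \<Longrightarrow> card K = 4 \<Longrightarrow> cov_model K E = cov_model K F"
      using part by auto
    interpret dag_pair V E F
      using fin sub loops acyc adj by unfold_locales auto
    show "cov_model V E = cov_model V F"
    proof (cases "card V < 3")
      case True
      \<comment> \<open>Here \<open>V = {i, j}\<close>, and the conditions of
        \<open>flippable\<close> range over no vertices.\<close>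
      have "flippable V E' F' i j" if ij: "(i, j) \<in> V \<times> V" "i \<noteq> j" for i j and E' F' :: "('v \<times> 'v) set"
      proof -
        have "V = {i, j}" using card_seteq[OF fin, of "{i, j}"] ij True by simp
        then show ?thesis by (simp add: flippable_def)
      qed
      then show ?thesis
        using cov_model_subset_if_flippable[OF dag_pair_axioms] cov_model_subset_if_flippable[OF swap] sub by blast
    next
      case False
      \<comment> \<open>Every \<open>K\<close> of at most four vertices extends to a four-element
        \<open>L\<close>, and equality of models passes from \<open>L\<close> down to
        \<open>K\<close>.\<close>
      have "cov_model K E = cov_model K F" if K: "K \<subseteq> V" "card K \<le> 4" for K
      proof -
        have "4 \<le> card V" using False assms(5) by simp
        then obtain L where L: "K \<subseteq> L" "L \<subseteq> V" "card L = 4"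
          using exists_subset_between[OF K(2) _ K(1) fin] by blast
        have "finite L" using L(2) fin by (rule finite_subset)
        then show ?thesis
          using cov_model_eq_subset[of L K E F] L loops four by blast
      qed
      then interpret locally_equivalent_dags V E F by unfold_locales
      show ?thesis
        using cov_model_subset locally_equivalent_dags.cov_model_subset[OF swap_local] by blast
    qed
  qed
qed

end
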